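(* Let $\Delta$ be a fixed positive integer. There is an algorithm that, given a graphic sequence $d$ all of whose entries are at most $\Delta$, determines $\gamma_{\min}(d)$ in polynomial time.
   Context: All graphs are finite, simple and undirected. A sequence $d=(d_1,\ldots,d_n)$ of non-negative integers is graphic if it is the degree sequence of some graph; such a graph is a realization of $d$, and $\mathcal{G}(d)$ is the set of all realizations of $d$. A set $D\subseteq V(G)$ is a dominating set of $G$ if every vertex in $V(G)\setminus D$ has a neighbor in $D$; $\gamma(G)$ is the minimum order of a dominating set of $G$. $\gamma_{\min}(d)=\min\{\gamma(G):G\in\mathcal{G}(d)\}$. The input is the list $(d_1,\ldots,d_n)$; "polynomial time" means running time bounded by a polynomial in the input length $n$, where the polynomial may depend on the fixed constant $\Delta$. *)

theory Defs
  imports Main "HOL-Computational_Algebra.Polynomial"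
begin

section \<open>Graphs, degree sequences and domination\<close>

definition simple_graph :: "'a set \<Rightarrow> 'a set set \<Rightarrow> bool" where
  "simple_graph V E \<longleftrightarrow> finite V \<and> (\<forall>e\<in>E. e \<subseteq> V \<and> card e = 2)"

definition vertex_degree :: "'a set set \<Rightarrow> 'a \<Rightarrow> nat" where
  "vertex_degree E v = card {e \<in> E. v \<in> e}"

definition dominating_set :: "'a set \<Rightarrow> 'a set set \<Rightarrow> 'a set \<Rightarrow> bool" where
  "dominating_set V E D \<longleftrightarrow> D \<subseteq> V \<and> (\<forall>v \<in> V - D. \<exists>u \<in> D. {u, v} \<in> E)"

definition domination_number :: "'a set \<Rightarrow> 'a set set \<Rightarrow> nat" where
  "domination_number V E = Min (card ` {D. dominating_set V E D})"

text \<open>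
  Natural numbers serve as vertex names; every finite graph is isomorphic to a graph of this
  kind. The enumeration \<open>vs\<close> is arbitrary, so the order of the entries of \<open>d\<close> is irrelevant.
\<close>

definition realizations :: "nat list \<Rightarrow> (nat set \<times> nat set set) set" where
  "realizations d =
     {(V, E). simple_graph V E \<and> (\<exists>vs. distinct vs \<and> set vs = V \<and> map (vertex_degree E) vs = d)}"

definition graphic :: "nat list \<Rightarrow> bool" where
  "graphic d \<longleftrightarrow> realizations d \<noteq> {}"

definition gamma_min :: "nat list \<Rightarrow> nat" where
  "gamma_min d = Min ((\<lambda>(V, E). domination_number V E) ` realizations d)"


section \<open>Random access machines\<close>

text \<open>
  A machine has registers and a separate, indirectly addressed memory, both holding natural
  numbers; each instruction takes one time step. Since addition and truncated subtraction are
  the only arithmetic operations, the bit length of the numbers grows by at most one per step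
  beyond that of the input and the constants of the program. Hence polynomially many steps here
  amount to polynomial time on a Turing machine, as usual for unit-cost machines without
  multiplication.
\<close>

datatype instr =
    Const nat nat    \<comment> \<open>\<open>Const i c\<close>: register \<open>i\<close> becomes \<open>c\<close>\<close>
  | Add nat nat nat  \<comment> \<open>\<open>Add i j k\<close>: register \<open>i\<close> becomes register \<open>j\<close> plus register \<open>k\<close>\<close>
  | Sub nat nat nat  \<comment> \<open>likewise for truncated subtraction\<close>
  | Load nat nat     \<comment> \<open>\<open>Load i j\<close>: register \<open>i\<close> becomes the cell whose address is in register \<open>j\<close>\<close>
  | Store nat nat    \<comment> \<open>\<open>Store i j\<close>: the cell whose address is in register \<open>i\<close> becomes register \<open>j\<close>\<close>
  | Jump nat
  | JumpZero nat nat \<comment> \<open>\<open>JumpZero i l\<close>: jump to \<open>l\<close> if register \<open>i\<close> is zero\<close>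

type_synonym program = "instr list"

text \<open>A configuration consists of the program counter, the registers and the memory.\<close>

type_synonym config = "nat \<times> (nat \<Rightarrow> nat) \<times> (nat \<Rightarrow> nat)"

fun exec :: "instr \<Rightarrow> config \<Rightarrow> config" where
  "exec (Const i c) (pc, r, m) = (Suc pc, r(i := c), m)"
| "exec (Add i j k) (pc, r, m) = (Suc pc, r(i := r j + r k), m)"
| "exec (Sub i j k) (pc, r, m) = (Suc pc, r(i := r j - r k), m)"
| "exec (Load i j) (pc, r, m) = (Suc pc, r(i := m (r j)), m)"
| "exec (Store i j) (pc, r, m) = (Suc pc, r, m(r i := r j))"
| "exec (Jump l) (pc, r, m) = (l, r, m)"
| "exec (JumpZero i l) (pc, r, m) = (if r i = 0 then l else Suc pc, r, m)"

definition halted :: "program \<Rightarrow> config \<Rightarrow> bool" where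
  "halted P s \<longleftrightarrow> length P \<le> fst s"

definition step :: "program \<Rightarrow> config \<Rightarrow> config" where
  "step P s = (if halted P s then s else exec (P ! fst s) s)"

text \<open>
  Initially register 0 holds the length of the input list and the first memory cells hold its
  entries; the remaining registers and cells are zero. The output is read from register 0.
\<close>

definition initial :: "nat list \<Rightarrow> config" where
  "initial xs =
     (0, (\<lambda>_. 0)(0 := length xs), \<lambda>a. if a < length xs then xs ! a else 0)"

definition outputs_within :: "program \<Rightarrow> nat list \<Rightarrow> nat \<Rightarrow> nat \<Rightarrow> bool" where
  "outputs_within P xs y T \<longleftrightarrow>
     (case (step P ^^ T) (initial xs) of (pc, r, m) \<Rightarrow> halted P (pc, r, m) \<and> r 0 = y)"

end

theory Submission
  imports Defs "HOL-Library.Multiset" "HOL-Library.Countable"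
begin

text \<open>
  Assign every vertex outside a dominating set \<open>D\<close> to a neighbour in \<open>D\<close>. Each vertex of \<open>D\<close>,
  together with the vertices assigned to it, has one of finitely many patterns of degrees, so a
  realization with a dominating set is recorded by a vector \<open>x\<close> counting patterns; the degree
  sequence and \<open>card D\<close> are linear in \<open>x\<close>. For \<open>N = (\<Delta> + 1)!\<close>, some graph consists of exactly \<open>N\<close>
  copies of any given pattern, so by disjoint unions the set of realizable vectors is closed under
  adding multiples of \<open>N\<close>. By Dickson's lemma, applied in each residue class modulo \<open>N\<close>, it is
  therefore a finite union of sets \<open>b + N * y\<close> with \<open>y\<close> an arbitrary vector of natural numbers. The
  finitely many \<open>b\<close> are hard-wired into the program, which counts the entries of \<open>d\<close> and searches
  through all \<open>y\<close> with entries at most \<open>length d\<close>.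
\<close>

section \<open>Realizations with a dominating set\<close>

text \<open>Degrees are kept as a multiset, which disjoint unions simply add. The vertex type is
  left open so that explicit constructions may use products and sums of types.\<close>

definition dominated_realization ::
    "'a set \<Rightarrow> 'a set set \<Rightarrow> 'a set \<Rightarrow> nat multiset \<Rightarrow> bool" where
  "dominated_realization V E D M \<longleftrightarrow> simple_graph V E \<and> dominating_set V E D \<and>
     image_mset (vertex_degree E) (mset_set V) = M"

text \<open>\<open>dominable (mset d) k\<close> means that some realization of \<open>d\<close> has
  domination number at most \<open>k\<close>.\<close>

definition dominable :: "nat multiset \<Rightarrow> nat \<Rightarrow> bool" where
  "dominable M k \<longleftrightarrow> (\<exists>(V :: nat set) E D. dominated_realization V E D M \<and> card D \<le> k)"

lemma simple_graph_finite: "simple_graph V E \<Longrightarrow> finite V \<and> finite E"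
  unfolding simple_graph_def by (metis PowI finite_Pow_iff finite_subset subsetI)

section \<open>Relabelling and disjoint union\<close>

lemma dominated_realization_relabel:
  assumes "inj_on f V" "dominated_realization V E D M"
  shows "dominated_realization (f ` V) (image f ` E) (f ` D) M"
proof -
  have V: "finite V" and E: "\<And>e. e \<in> E \<Longrightarrow> e \<subseteq> V \<and> card e = 2" and D: "D \<subseteq> V"
    and dom: "\<forall>v\<in>V - D. \<exists>u\<in>D. {u, v} \<in> E" and M: "image_mset (vertex_degree E) (mset_set V) = M"
    using assms(2) by (auto simp: dominated_realization_def simple_graph_def dominating_set_def)
  have deg: "vertex_degree (image f ` E) (f v) = vertex_degree E v" if "v \<in> V" for v
  proof -
    have "f v \<in> f ` e \<longleftrightarrow> v \<in> e" if "e \<in> E" for e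
      using inj_on_image_mem_iff[OF assms(1) \<open>v \<in> V\<close>, of e] E[OF that] by blast
    then have "{e \<in> image f ` E. f v \<in> e} = image f ` {e \<in> E. v \<in> e}"
      by blast
    moreover have "inj_on (image f) {e \<in> E. v \<in> e}"
      using E inj_on_image_Pow[OF assms(1)] by (auto intro: inj_on_subset)
    ultimately show ?thesis by (simp add: vertex_degree_def card_image)
  qed
  have "simple_graph (f ` V) (image f ` E)"
    using V E assms(1) by (auto simp: simple_graph_def) (metis card_image inj_on_subset)
  moreover have "dominating_set (f ` V) (image f ` E) (f ` D)"
    unfolding dominating_set_def
  proof (intro conjI ballI)
    fix w assume "w \<in> f ` V - f ` D"
    then obtain v where "w = f v" "v \<in> V - D" by auto
    then obtain u where "u \<in> D" "{u, v} \<in> E" using dom by blast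
    moreover have "{f u, w} = f ` {u, v}" using \<open>w = f v\<close> by simp
    ultimately have "f u \<in> f ` D" "{f u, w} \<in> image f ` E" by blast+
    then show "\<exists>u\<in>f ` D. {u, w} \<in> image f ` E" by blast
  qed (use D in auto)
  moreover have "image_mset (vertex_degree (image f ` E)) (mset_set (f ` V)) = M"
  proof -
    have "image_mset (vertex_degree (image f ` E)) (mset_set (f ` V))
        = image_mset (\<lambda>v. vertex_degree (image f ` E) (f v)) (mset_set V)"
      using assms(1) by (simp add: image_mset_mset_set[symmetric] multiset.map_comp o_def)
    also have "\<dots> = image_mset (vertex_degree E) (mset_set V)"
      using V deg by (intro image_mset_cong) auto
    finally show ?thesis using M by simp
  qed
  ultimately show ?thesis by (simp add: dominated_realization_def)
qed

lemma dominated_realization_union: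
  assumes "V \<inter> V' = {}" "dominated_realization V E D M" "dominated_realization V' E' D' M'"
  shows "dominated_realization (V \<union> V') (E \<union> E') (D \<union> D') (M + M')"
proof -
  have fin: "finite V" "finite V'" and E: "\<And>e. e \<in> E \<Longrightarrow> e \<subseteq> V" "\<And>e. e \<in> E' \<Longrightarrow> e \<subseteq> V'"
    using assms by (auto simp: dominated_realization_def simple_graph_def)
  have "{e \<in> E \<union> E'. v \<in> e} = {e \<in> E. v \<in> e}" if "v \<in> V" for v using that E assms(1) by blast
  then have 1: "vertex_degree (E \<union> E') v = vertex_degree E v" if "v \<in> V" for v
    using that by (simp add: vertex_degree_def)
  have "{e \<in> E \<union> E'. v \<in> e} = {e \<in> E'. v \<in> e}" if "v \<in> V'" for v using that E assms(1) by blast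
  then have 2: "vertex_degree (E \<union> E') v = vertex_degree E' v" if "v \<in> V'" for v
    using that by (simp add: vertex_degree_def)
  have "image_mset (vertex_degree (E \<union> E')) (mset_set (V \<union> V'))
      = image_mset (vertex_degree (E \<union> E')) (mset_set V)
        + image_mset (vertex_degree (E \<union> E')) (mset_set V')"
    using fin assms(1) by (simp add: mset_set_Union)
  also have "\<dots> = image_mset (vertex_degree E) (mset_set V)
        + image_mset (vertex_degree E') (mset_set V')"
    using fin 1 2 by (intro arg_cong2[where f = "(+)"] image_mset_cong) auto
  finally show ?thesis using assms
    by (auto simp: dominated_realization_def simple_graph_def dominating_set_def)
qed

text \<open>Graphs built on other countable types are carried to the natural numbers by the
  injection \<open>to_nat\<close>.\<close>

lemma dominableI:
  fixes V :: "'a::countable set"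
  assumes "dominated_realization V E D M" "card D \<le> k"
  shows "dominable M k"
proof -
  have "dominated_realization (to_nat ` V) (image to_nat ` E) (to_nat ` D) M"
    by (rule dominated_realization_relabel[OF _ assms(1)]) simp
  moreover have "card (to_nat ` D) \<le> k" using assms(2) by (simp add: card_image)
  ultimately show ?thesis unfolding dominable_def by blast
qed

lemma dominable_add:
  assumes "dominable M k" "dominable M' k'"
  shows "dominable (M + M') (k + k')"
proof -
  obtain V E D V' E' D' where 1: "dominated_realization (V :: nat set) E D M" "card D \<le> k"
    and 2: "dominated_realization (V' :: nat set) E' D' M'" "card D' \<le> k'"
    using assms unfolding dominable_def by blast
  have "dominated_realization (Inl ` V \<union> Inr ` V') (image Inl ` E \<union> image Inr ` E')
      (Inl ` D \<union> Inr ` D' :: (nat + nat) set) (M + M')"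
    by (intro dominated_realization_union dominated_realization_relabel 1 2) auto
  moreover have "card (Inl ` D \<union> Inr ` D' :: (nat + nat) set) \<le> k + k'"
    using card_Un_le[of "Inl ` D" "Inr ` D'"] 1 2 by (simp add: card_image)
  ultimately show ?thesis by (rule dominableI)
qed

lemma dominable_empty: "dominable {#} 0"
  unfolding dominable_def
  by (intro exI[of _ "{}"])
    (simp add: dominated_realization_def simple_graph_def dominating_set_def)

lemma dominable_repeat: "dominable M k \<Longrightarrow> dominable (repeat_mset n M) (n * k)"
  by (induction n) (auto simp: dominable_empty dominable_add)

lemma dominable_sum:
  assumes "finite A" "\<And>a. a \<in> A \<Longrightarrow> dominable (f a) (g a)"
  shows "dominable (sum f A) (sum g A)"
  using assms by (induction A rule: finite_induct) (auto simp: dominable_empty dominable_add)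

section \<open>Degree lists versus degree multisets\<close>

lemma image_mset_eq_mset_obtain:
  assumes "image_mset f M = mset xs"
  obtains ys where "mset ys = M" "map f ys = xs"
  using assms
proof (induction xs arbitrary: M thesis)
  case Nil
  then show ?case by simp
next
  case (Cons x xs)
  then obtain M' y where "M = add_mset y M'" "f y = x" "image_mset f M' = mset xs"
    using msed_map_invR[of f M x "mset xs"] by auto
  moreover from this Cons.IH obtain ys where "mset ys = M'" "map f ys = xs" by blast
  ultimately show ?case by (intro Cons.prems(1)[of "y # ys"]) auto
qed

text \<open>The enumeration \<open>vs\<close> is arbitrary, so only the multiset of degrees matters.
  Conversely, the list \<open>d\<close> of degrees lifts to a list \<open>vs\<close> of vertices; it
  is distinct because its length is the cardinality of its set \<open>V\<close>.\<close>

lemma realizations_iff: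
  "(V, E) \<in> realizations d \<longleftrightarrow>
     simple_graph V E \<and> image_mset (vertex_degree E) (mset_set V) = mset d"
proof
  assume "(V, E) \<in> realizations d"
  then obtain vs where "simple_graph V E" "distinct vs" "set vs = V" "map (vertex_degree E) vs = d"
    by (auto simp: realizations_def)
  then show "simple_graph V E \<and> image_mset (vertex_degree E) (mset_set V) = mset d"
    using mset_set_set by fastforce
next
  assume *: "simple_graph V E \<and> image_mset (vertex_degree E) (mset_set V) = mset d"
  then have fin: "finite V" by (simp add: simple_graph_def)
  obtain vs where "mset vs = mset_set V" "map (vertex_degree E) vs = d"
    using * image_mset_eq_mset_obtain by metis
  moreover from this have "set vs = V"
    using fin by (metis finite_set_mset_mset_set set_mset_mset)
  moreover from calculation have "distinct vs"
    using fin by (metis card_distinct size_mset size_mset_set)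
  ultimately show "(V, E) \<in> realizations d" using * by (auto simp: realizations_def)
qed

section \<open>Domination numbers as attained minima\<close>

lemma finite_dominating_sets: "finite V \<Longrightarrow> finite {D. dominating_set V E D}"
  by (rule finite_subset[of _ "Pow V"]) (auto simp: dominating_set_def)

lemma domination_number_le:
  "finite V \<Longrightarrow> dominating_set V E D \<Longrightarrow> domination_number V E \<le> card D"
  unfolding domination_number_def by (intro Min_le) (auto simp: finite_dominating_sets)

lemma domination_number_attained:
  assumes "finite V"
  obtains D where "dominating_set V E D" "card D = domination_number V E"
proof -
  have "dominating_set V E V" by (simp add: dominating_set_def)
  then have "domination_number V E \<in> card ` {D. dominating_set V E D}"
    unfolding domination_number_def by (intro Min_in) (auto simp: finite_dominating_sets assms)
  then show ?thesis using that by auto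
qed

text \<open>There may be infinitely many realizations, since vertex names are arbitrary natural
  numbers. \<open>Min\<close> in \<open>gamma_min\<close> is still meaningful: the whole vertex set
  dominates, so every value is at most \<open>length d\<close>.\<close>

lemma finite_domination_numbers:
  "finite ((\<lambda>(V, E). domination_number V E) ` realizations d)"
proof (rule finite_subset)
  show "(\<lambda>(V, E). domination_number V E) ` realizations d \<subseteq> {..length d}"
  proof clarsimp
    fix V E assume "(V, E) \<in> realizations d"
    then have "simple_graph V E" and M: "image_mset (vertex_degree E) (mset_set V) = mset d"
      by (auto simp: realizations_iff)
    then have "finite V" by (simp add: simple_graph_def)
    then have "domination_number V E \<le> card V"
      by (rule domination_number_le) (simp add: dominating_set_def)
    also have "card V = length d" using arg_cong[OF M, of size] by simp
    finally show "domination_number V E \<le> length d" .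
  qed
qed simp

lemma gamma_min_le:
  assumes "dominable (mset d) k"
  shows "gamma_min d \<le> k"
proof -
  obtain V E D where 1: "dominated_realization (V :: nat set) E D (mset d)" "card D \<le> k"
    using assms by (auto simp: dominable_def)
  then have "finite V" "dominating_set V E D" "(V, E) \<in> realizations d"
    by (auto simp: dominated_realization_def realizations_iff simple_graph_def)
  then have "domination_number V E \<le> card D"
    "gamma_min d \<le> domination_number V E"
    unfolding gamma_min_def
    by (auto intro!: domination_number_le Min_le finite_domination_numbers image_eqI[of _ _ "(V, E)"])
  with 1 show ?thesis by simp
qed

lemma gamma_min_attained:
  assumes "graphic d"
  obtains V E D where "dominated_realization (V :: nat set) E D (mset d)" "card D = gamma_min d"
proof -
  have "gamma_min d \<in> (\<lambda>(V, E). domination_number V E) ` realizations d"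
    unfolding gamma_min_def using assms
    by (intro Min_in finite_domination_numbers) (auto simp: graphic_def)
  then obtain V E where VE: "(V, E) \<in> realizations d" "gamma_min d = domination_number V E"
    by auto
  then have "simple_graph V E" "image_mset (vertex_degree E) (mset_set V) = mset d"
    by (auto simp: realizations_iff)
  moreover from this obtain D where "dominating_set V E D" "card D = domination_number V E"
    using domination_number_attained[of V E] by (auto simp: simple_graph_def)
  ultimately show ?thesis using that VE by (simp add: dominated_realization_def)
qed

section \<open>Patterns\<close>

text \<open>
  A pattern describes a vertex of a dominating set together with the vertices assigned to it: its
  head is the degree of the former, its tail lists the degrees of the latter.
\<close>

definition patterns :: "nat \<Rightarrow> nat list set" where
  "patterns \<Delta> = {i # js | i js. i \<le> \<Delta> \<and> length js \<le> i \<and> set js \<subseteq> {1..\<Delta>}}"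

lemma finite_patterns: "finite (patterns \<Delta>)"
proof (rule finite_subset)
  show "patterns \<Delta> \<subseteq> {xs. set xs \<subseteq> {..\<Delta>} \<and> length xs \<le> Suc \<Delta>}"
  proof
    fix xs assume "xs \<in> patterns \<Delta>"
    then obtain i js where "xs = i # js" "i \<le> \<Delta>" "length js \<le> i" "set js \<subseteq> {1..\<Delta>}"
      unfolding patterns_def by blast
    then show "xs \<in> {xs. set xs \<subseteq> {..\<Delta>} \<and> length xs \<le> Suc \<Delta>}" by fastforce
  qed
qed (rule finite_lists_length_le, simp)

section \<open>Copies of a pattern: stars completed by cliques\<close>

lemma graph_of_relation:
  assumes "finite V" "\<And>u v. adj u v \<Longrightarrow> adj v u" "\<And>u. \<not> adj u u"
  defines "E \<equiv> {{u, v} | u v. u \<in> V \<and> v \<in> V \<and> adj u v}"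
  shows "simple_graph V E" "v \<in> V \<Longrightarrow> vertex_degree E v = card {u \<in> V. adj v u}"
proof -
  show "simple_graph V E"
    using assms(1,3) unfolding simple_graph_def E_def by (auto simp: card_insert_if)
  show "vertex_degree E v = card {u \<in> V. adj v u}" if "v \<in> V"
  proof -
    have "{e \<in> E. v \<in> e} = (\<lambda>u. {v, u}) ` {u \<in> V. adj v u}"
      using that assms(2) unfolding E_def by (auto simp: insert_commute)
    moreover have "inj_on (\<lambda>u. {v, u}) {u \<in> V. adj v u}"
      by (auto simp: inj_on_def doubleton_eq_iff)
    ultimately show ?thesis by (simp add: vertex_degree_def card_image)
  qed
qed

text \<open>The fibres of division by \<open>k\<close> are intervals of length \<open>k\<close>; as
  \<open>k\<close> divides \<open>N\<close>, the last one below \<open>N\<close> is complete as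
  well. These blocks serve as cliques on the \<open>N\<close> copies of a vertex.\<close>

lemma card_block:
  fixes k N c :: nat
  assumes "k dvd N" "c < N"
  shows "card {c'. c' < N \<and> c' \<noteq> c \<and> c div k = c' div k} = k - 1"
proof -
  obtain t where t: "N = k * t" using assms(1) by blast
  then have k: "k > 0" using assms(2) by (cases k) auto
  have "c div k < t" using assms(2) t by (simp add: less_mult_imp_div_less mult.commute)
  then have le: "c div k * k + k \<le> N"
    using mult_le_mono1[of "Suc (c div k)" t k] by (simp add: t algebra_simps)
  have block: "c div k = c' div k \<longleftrightarrow> c' \<in> {c div k * k..<c div k * k + k}" for c'
  proof
    assume "c div k = c' div k"
    then show "c' \<in> {c div k * k..<c div k * k + k}"
      using div_times_less_eq_dividend[of c' k] dividend_less_div_times[OF k, of c']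
      by (simp add: add.commute)
  next
    assume "c' \<in> {c div k * k..<c div k * k + k}"
    then show "c div k = c' div k"
      using div_nat_eqI[of k "c div k" c'] by (simp add: mult.commute)
  qed
  have "{c'. c' < N \<and> c' \<noteq> c \<and> c div k = c' div k} = {c div k * k..<c div k * k + k} - {c}"
    unfolding block using le by fastforce
  moreover have "c \<in> {c div k * k..<c div k * k + k}"
    using block[of c] by simp
  ultimately show ?thesis by simp
qed

lemma image_mset_nth_product:
  "image_mset (\<lambda>(c, l). xs ! l) (mset_set ({..<N} \<times> {..<length xs})) = repeat_mset N (mset xs)"
proof (induction N)
  case (Suc N)
  have "{..<Suc N} \<times> {..<length xs} = Pair N ` {..<length xs} \<union> {..<N} \<times> {..<length xs}"
    by auto
  then have "mset_set ({..<Suc N} \<times> {..<length xs})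
      = mset_set (Pair N ` {..<length xs}) + mset_set ({..<N} \<times> {..<length xs})"
    by (simp only:) (rule mset_set_Union, auto)
  moreover have "mset_set (Pair N ` {..<length xs}) = image_mset (Pair N) (mset_set {..<length xs})"
    by (rule image_mset_mset_set[symmetric]) (simp add: inj_on_def)
  moreover have "image_mset ((!) xs) (mset_set {..<length xs}) = mset xs"
    by (metis atLeast_upt map_nth mset_map mset_set_upto_eq_mset_upto)
  ultimately show ?case using Suc by (simp add: multiset.map_comp o_def)
qed simp

text \<open>
  Take \<open>N\<close> copies of the star with centre of degree \<open>hd xs\<close> and leaves of degrees \<open>tl xs\<close>. The
  missing degrees are supplied by partitioning the \<open>N\<close> copies of each vertex into cliques of equal
  size, which is possible since \<open>N\<close> is divisible by every number up to \<open>\<Delta> + 1\<close>.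
\<close>

lemma dominable_pattern:
  assumes "xs \<in> patterns \<Delta>"
  shows "dominable (repeat_mset (fact (Suc \<Delta>)) (mset xs)) (fact (Suc \<Delta>))"
proof -
  define N :: nat where "N = fact (Suc \<Delta>)"
  obtain i js where xs: "xs = i # js" "i \<le> \<Delta>" "length js \<le> i" "set js \<subseteq> {1..\<Delta>}"
    using assms by (auto simp: patterns_def)
  \<comment> \<open>The size of the cliques on the copies of position \<open>l\<close>. The centre
    has \<open>length js\<close> neighbours in its star and lacks \<open>i - length js\<close>; a
    leaf has one and lacks \<open>xs ! l - 1\<close>. A clique supplies one less than its
    size.\<close>
  define k where "k l = (if l = 0 then Suc (i - length js) else xs ! l)" for l
  define V where "V = {..<N} \<times> {..<length xs}"
  \<comment> \<open>Pairs consist of a copy and a position. The first alternative gives the stars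
    within a copy, the second the cliques across copies of one position.\<close>
  define adj where "adj = (\<lambda>(c, l) (c', l'). c = c' \<and> (l = 0) \<noteq> (l' = 0) \<or>
      l = l' \<and> c' \<noteq> c \<and> c div k l = c' div k l)" for c l c' l' :: nat
  define E where "E = {{u, v} | u v. u \<in> V \<and> v \<in> V \<and> adj u v}"
  have "finite V" by (simp add: V_def)
  moreover have "adj v u" if "adj u v" for u v using that by (auto simp: adj_def)
  moreover have "\<not> adj u u" for u by (auto simp: adj_def)
  ultimately have graph: "simple_graph V E"
      "\<And>v. v \<in> V \<Longrightarrow> vertex_degree E v = card {u \<in> V. adj v u}"
    unfolding E_def by (blast intro: graph_of_relation)+
  have k: "k l dvd N \<and> 1 \<le> k l" if "l < length xs" for l
  proof -
    have "1 \<le> k l \<and> k l \<le> Suc \<Delta>"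
    proof (cases l)
      case 0
      then show ?thesis using xs by (simp add: k_def)
    next
      case (Suc l')
      then have "xs ! l \<in> set js" using that xs(1) by auto
      with Suc xs(4) show ?thesis by (fastforce simp: k_def)
    qed
    then show ?thesis unfolding N_def using dvd_fact by blast
  qed
  have deg: "vertex_degree E (c, l) = xs ! l" if "(c, l) \<in> V" for c l
  proof -
    have c: "c < N" and l: "l < length xs" using that by (auto simp: V_def)
    let ?A = "Pair c ` {l'. l' < length xs \<and> (l = 0) \<noteq> (l' = 0)}"
    let ?B = "(\<lambda>c'. (c', l)) ` {c'. c' < N \<and> c' \<noteq> c \<and> c div k l = c' div k l}"
    have "{u \<in> V. adj (c, l) u} = ?A \<union> ?B" using c l by (auto simp: V_def adj_def)
    moreover have "card (?A \<union> ?B) = card ?A + card ?B"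
      by (intro card_Un_disjoint) auto
    moreover have "card ?A = (if l = 0 then length js else 1)"
    proof -
      have "{l'. l' < length xs \<and> (l = 0) \<noteq> (l' = 0)} = (if l = 0 then {1..<length xs} else {0})"
        using l by auto
      then show ?thesis using xs(1) by (simp add: card_image inj_on_def)
    qed
    moreover have "card ?B = k l - 1"
      using card_block[of "k l" N c] k[OF l] c by (simp add: card_image inj_on_def)
    ultimately have "vertex_degree E (c, l) = (if l = 0 then length js else 1) + (k l - 1)"
      using graph(2)[OF that] by simp
    then show ?thesis using k[OF l] xs by (auto simp: k_def)
  qed
  have "image_mset (vertex_degree E) (mset_set V) = image_mset (\<lambda>(c, l). xs ! l) (mset_set V)"
    using deg \<open>finite V\<close> by (intro image_mset_cong) auto
  then have "image_mset (vertex_degree E) (mset_set V) = repeat_mset N (mset xs)"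
    by (simp add: V_def image_mset_nth_product)
  moreover have "dominating_set V E ((\<lambda>c. (c, 0)) ` {..<N})"
    unfolding dominating_set_def
  proof (intro conjI ballI)
    show "(\<lambda>c. (c, 0)) ` {..<N} \<subseteq> V" using xs by (auto simp: V_def)
    fix v assume "v \<in> V - (\<lambda>c. (c, 0)) ` {..<N}"
    then obtain c l where v: "v = (c, l)" "c < N" "l < length xs" "l \<noteq> 0"
      by (cases v) (auto simp: V_def)
    then have "(c, 0) \<in> V" "(c, l) \<in> V" "adj (c, 0) (c, l)" by (auto simp: V_def adj_def)
    then have "{(c, 0), v} \<in> E" using v unfolding E_def by blast
    then show "\<exists>u\<in>(\<lambda>c. (c, 0)) ` {..<N}. {u, v} \<in> E" using v by blast
  qed
  ultimately have "dominated_realization V E ((\<lambda>c. (c, 0)) ` {..<N}) (repeat_mset N (mset xs))"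
    using graph(1) by (simp add: dominated_realization_def)
  then show ?thesis unfolding N_def[symmetric]
    by (rule dominableI) (simp add: card_image inj_on_def)
qed

section \<open>Reading off the patterns of a dominated graph\<close>

lemma sum_constant_mset: "finite A \<Longrightarrow> (\<Sum>a\<in>A. M) = repeat_mset (card A) M"
  by (induction A rule: finite_induct) auto

lemma image_mset_mset_set_eq_sum: "image_mset f (mset_set A) = (\<Sum>a\<in>A. {#f a#})"
  by (simp only: sum_unfold_sum_mset sum_mset_singleton_mset)

definition pattern_mset :: "nat \<Rightarrow> (nat list \<Rightarrow> nat) \<Rightarrow> nat multiset" where
  "pattern_mset \<Delta> x = (\<Sum>\<pi>\<in>patterns \<Delta>. repeat_mset (x \<pi>) (mset \<pi>))"

text \<open>Each vertex outside \<open>D\<close> chooses a neighbour \<open>p v\<close> in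
  \<open>D\<close>, and \<open>x\<close> counts the vertices of \<open>D\<close> by the resulting
  pattern. The bound on each \<open>x \<pi>\<close> later limits the range of the search.\<close>

lemma dominated_realization_patterns:
  assumes "dominated_realization (V :: nat set) E D M" "\<forall>i\<in>#M. i \<le> \<Delta>"
  obtains x where "pattern_mset \<Delta> x = M" "(\<Sum>\<pi>\<in>patterns \<Delta>. x \<pi>) = card D" "\<And>\<pi>. x \<pi> \<le> card D"
proof -
  have graph: "simple_graph V E" and D: "D \<subseteq> V"
    and dom: "\<forall>v\<in>V - D. \<exists>u\<in>D. {u, v} \<in> E" and M: "M = image_mset (vertex_degree E) (mset_set V)"
    using assms(1) by (auto simp: dominated_realization_def dominating_set_def)
  have fin: "finite V" "finite E" "finite D"
    using simple_graph_finite[OF graph] finite_subset[OF D] by auto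
  obtain p where p: "\<And>v. v \<in> V - D \<Longrightarrow> p v \<in> D \<and> {p v, v} \<in> E"
    using dom by metis
  define ch where "ch u = {v \<in> V - D. p v = u}" for u
  define pat where
    "pat u = vertex_degree E u # map (vertex_degree E) (sorted_list_of_set (ch u))" for u
  have fin_ch: "finite (ch u)" for u using fin by (simp add: ch_def)
  have deg: "vertex_degree E v \<le> \<Delta>" if "v \<in> V" for v
    using assms(2) that fin by (simp add: M)
  have pat: "pat u \<in> patterns \<Delta>" if "u \<in> D" for u
  proof -
    \<comment> \<open>The vertices assigned to \<open>u\<close> give distinct edges at
      \<open>u\<close>.\<close>
    have "card (ch u) \<le> vertex_degree E u"
      unfolding vertex_degree_def
    proof (rule card_inj_on_le[of "\<lambda>v. {u, v}"])
      show "inj_on (\<lambda>v. {u, v}) (ch u)" by (auto simp: inj_on_def doubleton_eq_iff)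
    qed (use p fin in \<open>auto simp: ch_def\<close>)
    moreover have "1 \<le> vertex_degree E v" if "v \<in> ch u" for v
    proof -
      have "{u, v} \<in> {e \<in> E. v \<in> e}" using p[of v] that by (auto simp: ch_def)
      moreover have "finite {e \<in> E. v \<in> e}" using fin by simp
      ultimately have "card {e \<in> E. v \<in> e} > 0" by (metis card_gt_0_iff empty_iff)
      then show ?thesis by (simp add: vertex_degree_def)
    qed
    moreover have "ch u \<subseteq> V" by (auto simp: ch_def)
    ultimately show ?thesis
      using deg that D fin_ch by (auto simp: patterns_def pat_def)
  qed
  define x where "x \<pi> = card {u \<in> D. pat u = \<pi>}" for \<pi>
  \<comment> \<open>Stated for any commutative monoid: it is applied to multisets of degrees and,
    with \<open>h\<close> constantly 1, to the cardinality of \<open>D\<close>.\<close>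
  have group: "(\<Sum>\<pi>\<in>patterns \<Delta>. \<Sum>u | u \<in> D \<and> pat u = \<pi>. h u) = sum h D"
    for h :: "nat \<Rightarrow> 'b::comm_monoid_add"
    using fin finite_patterns pat by (intro sum.group) auto
  have "pattern_mset \<Delta> x = (\<Sum>\<pi>\<in>patterns \<Delta>. \<Sum>u | u \<in> D \<and> pat u = \<pi>. mset (pat u))"
    unfolding pattern_mset_def x_def using fin
    by (intro sum.cong refl) (simp add: sum_constant_mset[symmetric])
  also have "\<dots> = (\<Sum>u\<in>D. mset (pat u))" by (rule group)
  also have "\<dots> = (\<Sum>u\<in>D. {#vertex_degree E u#} + (\<Sum>v\<in>ch u. {#vertex_degree E v#}))"
    by (intro sum.cong refl) (simp add: pat_def image_mset_mset_set_eq_sum[symmetric]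
          flip: sorted_list_of_mset_set)
  also have "\<dots> = (\<Sum>u\<in>D. {#vertex_degree E u#}) + (\<Sum>v\<in>V - D. {#vertex_degree E v#})"
  proof -
    have "(\<Sum>u\<in>D. \<Sum>v\<in>ch u. {#vertex_degree E v#}) = (\<Sum>v\<in>V - D. {#vertex_degree E v#})"
      unfolding ch_def using fin p by (intro sum.group) auto
    then show ?thesis by (simp only: sum.distrib)
  qed
  also have "\<dots> = M"
    using sum.subset_diff[OF D fin(1), of "\<lambda>v. {#vertex_degree E v#}"]
    by (simp add: M image_mset_mset_set_eq_sum add.commute)
  finally have "pattern_mset \<Delta> x = M" .
  moreover have "(\<Sum>\<pi>\<in>patterns \<Delta>. x \<pi>) = card D"
    using group[of "\<lambda>_. 1 :: nat"] by (simp add: x_def)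
  moreover have "x \<pi> \<le> card D" for \<pi>
    unfolding x_def using fin by (intro card_mono) auto
  ultimately show ?thesis by (rule that)
qed

lemma pattern_mset_add:
  "pattern_mset \<Delta> (\<lambda>\<pi>. x \<pi> + y \<pi>) = pattern_mset \<Delta> x + pattern_mset \<Delta> y"
  by (simp add: pattern_mset_def sum.distrib repeat_mset_distrib)

text \<open>Any vector of multiples of \<open>fact (Suc \<Delta>)\<close> is realizable: it is a
  disjoint union of the graphs from \<open>dominable_pattern\<close>.\<close>

lemma dominable_pattern_mset_fact:
  "dominable (pattern_mset \<Delta> (\<lambda>\<pi>. fact (Suc \<Delta>) * y \<pi>)) (\<Sum>\<pi>\<in>patterns \<Delta>. fact (Suc \<Delta>) * y \<pi>)"
  unfolding pattern_mset_def
proof (rule dominable_sum[OF finite_patterns])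
  fix \<pi> assume "\<pi> \<in> patterns \<Delta>"
  from dominable_repeat[OF dominable_pattern[OF this], of "y \<pi>"]
  show "dominable (repeat_mset (fact (Suc \<Delta>) * y \<pi>) (mset \<pi>)) (fact (Suc \<Delta>) * y \<pi>)"
    by (simp add: mult.commute del: fact_Suc)
qed

section \<open>Dickson's lemma with congruences\<close>

text \<open>Induction on the set of coordinates. For a new coordinate \<open>i\<close>, take bases
  of the slices of \<open>A\<close> with given residue at \<open>i\<close>, and let \<open>m\<close>
  bound their values at \<open>i\<close>. Vectors with value at least \<open>m\<close> lie above one
  of these; the finitely many smaller values get a basis each.\<close>

lemma dickson_mod:
  fixes A :: "('a \<Rightarrow> nat) set" and N :: nat
  assumes "finite I" "N > 0"
  shows "\<exists>B\<subseteq>A. finite B \<and> (\<forall>a\<in>A. \<exists>b\<in>B. \<forall>i\<in>I. b i \<le> a i \<and> N dvd a i - b i)"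
  using assms(1)
proof (induction I arbitrary: A rule: finite_induct)
  case empty
  show ?case
  proof (cases "A = {}")
    case False
    then obtain a where "a \<in> A" by blast
    then show ?thesis by (intro exI[of _ "{a}"]) auto
  qed auto
next
  case (insert i I)
  let ?below = "\<lambda>I b a. \<forall>i\<in>I. b i \<le> a i \<and> N dvd a i - b i"
  \<comment> \<open>The induction hypothesis is needed for many slices of \<open>A\<close> at once,
    so a basis is chosen for every predicate \<open>P\<close>.\<close>
  have "\<forall>P. \<exists>B\<subseteq>{a \<in> A. P a}. finite B \<and> (\<forall>a\<in>{a \<in> A. P a}. \<exists>b\<in>B. ?below I b a)"
    using insert.IH by blast
  from choice[OF this] obtain basis where *: "\<forall>P. basis P \<subseteq> {a \<in> A. P a} \<and> finite (basis P) \<and>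
      (\<forall>a\<in>{a \<in> A. P a}. \<exists>b\<in>basis P. ?below I b a)" ..
  have basis: "basis P \<subseteq> {a \<in> A. P a}" "finite (basis P)"
    "a \<in> A \<Longrightarrow> P a \<Longrightarrow> \<exists>b\<in>basis P. ?below I b a" for P a
    using spec[OF *, of P] by auto
  define R where "R = (\<Union>\<rho><N. basis (\<lambda>a. a i mod N = \<rho>))"
  have fin: "finite R" using basis(2) by (simp add: R_def)
  \<comment> \<open>The inserted 0 covers the case that \<open>R\<close> is empty.\<close>
  define m where "m = Max (insert 0 ((\<lambda>b. b i) ` R))"
  have m: "b i \<le> m" if "b \<in> R" for b
    using that fin unfolding m_def by (intro Max_ge) auto
  define B where "B = R \<union> (\<Union>v<m. basis (\<lambda>a. a i = v))"
  have "B \<subseteq> A" "finite B" using basis(1,2) fin by (auto simp: B_def R_def)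
  moreover have "\<exists>b\<in>B. ?below (insert i I) b a" if a: "a \<in> A" for a
  proof (cases "a i < m")
    case True
    obtain b where b: "b \<in> basis (\<lambda>a'. a' i = a i)" "?below I b a"
      using basis(3)[OF a, of "\<lambda>a'. a' i = a i"] by blast
    then have "b i = a i" using basis(1) by blast
    then show ?thesis using b True by (intro bexI[of _ b]) (auto simp: B_def)
  next
    case False
    obtain b where b: "b \<in> basis (\<lambda>a'. a' i mod N = a i mod N)" "?below I b a"
      using basis(3)[OF a, of "\<lambda>a'. a' i mod N = a i mod N"] by blast
    have "b \<in> R" using b(1) assms(2) by (auto simp: R_def)
    moreover have "b i mod N = a i mod N" using b(1) basis(1) by blast
    moreover have "b i \<le> a i" using m[OF \<open>b \<in> R\<close>] False by simp
    ultimately have "b i \<le> a i \<and> N dvd a i - b i"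
      using mod_eq_dvd_iff_nat[of "b i" "a i" N] by simp
    then show ?thesis using b(2) \<open>b \<in> R\<close> by (intro bexI[of _ b]) (auto simp: B_def)
  qed
  ultimately show ?case by blast
qed

section \<open>Timed correctness of structured programs\<close>

type_synonym store = "(nat \<Rightarrow> nat) \<times> (nat \<Rightarrow> nat)"

text \<open>Loops run while a register is nonzero. Jumps arise only in compilation, so that
  correctness and running time compose; blocks are meant to be straight-line code.\<close>

datatype com = Block "instr list" | Seq com com | While nat com

fun clen :: "com \<Rightarrow> nat" where
  "clen (Block is) = length is"
| "clen (Seq c1 c2) = clen c1 + clen c2"
| "clen (While i c) = clen c + 2"

text \<open>Jump targets are absolute, hence the parameter \<open>off\<close> for the position of
  the code. A loop adds two instructions, the test in front and the jump back, and exits to the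
  address after both.\<close>

fun compile :: "com \<Rightarrow> nat \<Rightarrow> program" where
  "compile (Block is) off = is"
| "compile (Seq c1 c2) off = compile c1 off @ compile c2 (off + clen c1)"
| "compile (While i c) off =
     JumpZero i (off + clen c + 2) # compile c (Suc off) @ [Jump off]"

lemma length_compile [simp]: "length (compile c off) = clen c"
  by (induction c arbitrary: off) auto

fun straight :: "instr \<Rightarrow> bool" where
  "straight (Jump l) = False"
| "straight (JumpZero i l) = False"
| "straight _ = True"

fun run :: "instr list \<Rightarrow> store \<Rightarrow> store" where
  "run [] s = s"
| "run (i # is) s = run is (snd (exec i (0, s)))"

lemma run_append [simp]: "run (is @ js) s = run js (run is s)"
  by (induction "is" arbitrary: s) auto

text \<open>Quantifying over the surrounding code makes the statement independent of position; the
  number of steps is exact so that it adds up under composition.\<close>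

definition terminates :: "com \<Rightarrow> store \<Rightarrow> nat \<Rightarrow> store \<Rightarrow> bool" where
  "terminates c s t s' \<longleftrightarrow> (\<forall>pre post.
     (step (pre @ compile c (length pre) @ post) ^^ t) (length pre, s) = (length pre + clen c, s'))"

lemma terminatesD:
  assumes "terminates c s t s'" "P = pre @ compile c (length pre) @ post" "l = length pre"
  shows "(step P ^^ t) (l, s) = (l + clen c, s')"
  using assms by (simp add: terminates_def)

lemma exec_straight: "straight i \<Longrightarrow> exec i (pc, s) = (Suc pc, snd (exec i (0, s)))"
  by (cases i; cases s) auto

lemma step_append: "step (pre @ i # post) (length pre, s) = exec i (length pre, s)"
  by (simp add: step_def halted_def nth_append)

lemma terminates_Block:
  "\<forall>i\<in>set is. straight i \<Longrightarrow> terminates (Block is) s (length is) (run is s)"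
proof (induction "is" arbitrary: s)
  case Nil
  then show ?case by (simp add: terminates_def)
next
  case (Cons i "is")
  show ?case unfolding terminates_def
  proof (intro allI)
    fix pre post
    let ?P = "pre @ compile (Block (i # is)) (length pre) @ post"
    have 1: "(step ?P ^^ length is) (Suc (length pre), snd (exec i (0, s)))
      = (Suc (length pre) + clen (Block is), run is (snd (exec i (0, s))))"
      by (rule terminatesD[OF Cons.IH, of _ "pre @ [i]" post]) (use Cons.prems in auto)
    have 2: "step ?P (length pre, s) = (Suc (length pre), snd (exec i (0, s)))"
      using Cons.prems step_append[of pre i "is @ post" s] exec_straight[of i "length pre" s]
      by (simp del: exec.simps)
    have "(step ?P ^^ length (i # is)) (length pre, s) = (step ?P ^^ length is) (step ?P (length pre, s))"
      by (simp only: list.size add_0_right add_Suc_right funpow_Suc_right o_apply)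
    also have "\<dots> = (length pre + clen (Block (i # is)), run (i # is) s)"
      unfolding 2 1 by simp
    finally show "(step ?P ^^ length (i # is)) (length pre, s)
      = (length pre + clen (Block (i # is)), run (i # is) s)" .
  qed
qed

lemma terminates_Seq:
  assumes "terminates c1 s t1 s1" "terminates c2 s1 t2 s2"
  shows "terminates (Seq c1 c2) s (t1 + t2) s2"
  unfolding terminates_def
proof (intro allI)
  fix pre post
  let ?P = "pre @ compile (Seq c1 c2) (length pre) @ post"
  have "(step ?P ^^ t1) (length pre, s) = (length pre + clen c1, s1)"
    by (rule terminatesD[OF assms(1)]) auto
  moreover have "(step ?P ^^ t2) (length pre + clen c1, s1) = (length pre + clen c1 + clen c2, s2)"
    by (rule terminatesD[OF assms(2), of _ "pre @ compile c1 (length pre)"]) auto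
  ultimately show "(step ?P ^^ (t1 + t2)) (length pre, s) = (length pre + clen (Seq c1 c2), s2)"
    by (subst add.commute) (simp add: funpow_add)
qed

lemma terminates_While_zero: "fst s i = 0 \<Longrightarrow> terminates (While i c) s 1 s"
  unfolding terminates_def by (cases s) (simp add: step_append)

lemma terminates_While_step:
  assumes "fst s i \<noteq> 0" "terminates c s t1 s1" "terminates (While i c) s1 t2 s2"
  shows "terminates (While i c) s (t1 + t2 + 2) s2"
  unfolding terminates_def
proof (intro allI)
  fix pre post
  let ?P = "pre @ compile (While i c) (length pre) @ post"
  have 1: "step ?P (length pre, s) = (Suc (length pre), s)"
    using assms(1) by (cases s) (simp add: step_append)
  have 2: "(step ?P ^^ t1) (Suc (length pre), s) = (Suc (length pre) + clen c, s1)"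
    by (rule terminatesD[OF assms(2),
          of _ "pre @ [JumpZero i (length pre + clen c + 2)]" "Jump (length pre) # post"]) auto
  have P: "?P = (pre @ JumpZero i (length pre + clen c + 2) # compile c (Suc (length pre)))
      @ Jump (length pre) # post"
    by simp
  have 3: "step ?P (Suc (length pre) + clen c, s1) = (length pre, s1)"
    using step_append[of "pre @ JumpZero i (length pre + clen c + 2) # compile c (Suc (length pre))"
        "Jump (length pre)" post s1]
    unfolding P[symmetric] by (cases s1) simp
  have 4: "(step ?P ^^ t2) (length pre, s1) = (length pre + clen (While i c), s2)"
    by (rule terminatesD[OF assms(3)]) auto
  \<comment> \<open>Powers compose from right to left: first the test, then the body, the jump back,
    and the remaining rounds.\<close>
  have "t1 + t2 + 2 = t2 + Suc (t1 + Suc 0)" by simp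
  then show "(step ?P ^^ (t1 + t2 + 2)) (length pre, s) = (length pre + clen (While i c), s2)"
    using 1 2 3 4 by (simp only: funpow_add funpow.simps o_apply id_apply)
qed

section \<open>Hoare triples with time bounds\<close>

definition triple :: "nat \<Rightarrow> (store \<Rightarrow> bool) \<Rightarrow> com \<Rightarrow> (store \<Rightarrow> bool) \<Rightarrow> bool" where
  "triple T A c B \<longleftrightarrow> (\<forall>s. A s \<longrightarrow> (\<exists>t s'. t \<le> T \<and> B s' \<and> terminates c s t s'))"

lemma triple_conseq:
  assumes "triple T' A' c B'" "\<And>s. A s \<Longrightarrow> A' s" "\<And>s. B' s \<Longrightarrow> B s" "T' \<le> T"
  shows "triple T A c B"
  using assms unfolding triple_def by (meson order_trans)

lemma triple_Block:
  assumes "\<forall>i\<in>set is. straight i" "\<And>r m. A (r, m) \<Longrightarrow> B (run is (r, m))"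
  shows "triple (length is) A (Block is) B"
  unfolding triple_def using terminates_Block[OF assms(1)] assms(2) by fastforce

lemma triple_Seq:
  assumes "triple T1 A c1 B" "triple T2 B c2 C"
  shows "triple (T1 + T2) A (Seq c1 c2) C"
  unfolding triple_def
proof (intro allI impI)
  fix s assume "A s"
  then obtain t1 s1 where 1: "t1 \<le> T1" "B s1" "terminates c1 s t1 s1"
    using assms(1) unfolding triple_def by blast
  then obtain t2 s2 where 2: "t2 \<le> T2" "C s2" "terminates c2 s1 t2 s2"
    using assms(2) unfolding triple_def by blast
  show "\<exists>t s'. t \<le> T1 + T2 \<and> C s' \<and> terminates (Seq c1 c2) s t s'"
    using terminates_Seq[OF 1(3) 2(3)] 1 2 by (intro exI[of _ "t1 + t2"] exI[of _ s2]) auto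
qed

text \<open>The invariant \<open>J\<close> is indexed by the value of the tested register, which
  counts the remaining rounds. Each round pays two steps for test and jump, and the final test one
  more.\<close>

lemma triple_While:
  assumes "\<And>j. j < k \<Longrightarrow> triple T (J (Suc j)) c (J j)" "\<And>j r m. J j (r, m) \<Longrightarrow> r i = j"
  shows "triple (k * (T + 2) + 1) (J k) (While i c) (J 0)"
  using assms(1)
proof (induction k)
  case 0
  show ?case unfolding triple_def
  proof (intro allI impI)
    fix s assume J: "J 0 s"
    then have "fst s i = 0" using assms(2)[of 0 "fst s" "snd s"] by simp
    from J terminates_While_zero[OF this, of c]
    show "\<exists>t s'. t \<le> 0 * (T + 2) + 1 \<and> J 0 s' \<and> terminates (While i c) s t s'"
      by (intro exI[of _ 1] exI[of _ s]) simp
  qed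
next
  case (Suc k)
  show ?case unfolding triple_def
  proof (intro allI impI)
    fix s assume J: "J (Suc k) s"
    then have nz: "fst s i \<noteq> 0" using assms(2)[of "Suc k" "fst s" "snd s"] by simp
    obtain t1 s1 where 1: "t1 \<le> T" "J k s1" "terminates c s t1 s1"
      using Suc.prems[of k] J unfolding triple_def by blast
    obtain t2 s2 where 2: "t2 \<le> k * (T + 2) + 1" "J 0 s2" "terminates (While i c) s1 t2 s2"
      using Suc.IH[OF Suc.prems] 1(2) unfolding triple_def by (meson less_SucI)
    have "t1 + t2 + 2 \<le> Suc k * (T + 2) + 1" using 1 2 by simp
    with 2 terminates_While_step[OF nz 1(3) 2(3)]
    show "\<exists>t s'. t \<le> Suc k * (T + 2) + 1 \<and> J 0 s' \<and> terminates (While i c) s t s'" by blast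
  qed
qed

text \<open>A halted configuration is a fixed point of \<open>step\<close>, so a bound on the time
  can replace the exact time.\<close>

lemma triple_outputs:
  assumes "triple T A c (\<lambda>(r, m). r 0 = y)" "A (snd (initial d))"
  shows "outputs_within (compile c 0) d y T"
proof -
  let ?P = "compile c 0"
  obtain t r m where t: "t \<le> T" "r 0 = y" "terminates c (snd (initial d)) t (r, m)"
    using assms unfolding triple_def by fastforce
  have "(step ?P ^^ t) (0, snd (initial d)) = (0 + clen c, (r, m))"
    by (rule terminatesD[OF t(3), of _ "[]" "[]"]) auto
  then have 1: "(step ?P ^^ t) (initial d) = (clen c, r, m)"
    by (simp add: initial_def)
  have 2: "(step ?P ^^ j) (clen c, r, m) = (clen c, r, m)" for j
    by (induction j) (auto simp: step_def halted_def)
  have "T = (T - t) + t" using t by simp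
  then have "(step ?P ^^ T) (initial d) = (clen c, r, m)"
    using 1 2 funpow_add[of "T - t" t "step ?P"] by simp
  then show ?thesis using t by (simp add: outputs_within_def halted_def)
qed

section \<open>Exhaustive search\<close>

text \<open>Register layout: 0 holds the best value so far, 1 the input length, 2 the constant 1,
  \<open>7 + j\<close> the number of entries equal to \<open>j\<close>; the search variables come
  after these counters.\<close>

definition scratch :: "nat set" where "scratch = {3, 4, 5, 6}"

text \<open>A linear form is a list of registers with coefficients expressed by repetition, so
  \<open>Add\<close> suffices to evaluate it; repetitions of register 2 yield constants.\<close>

definition reg_sum :: "(nat \<Rightarrow> nat) \<Rightarrow> nat list \<Rightarrow> nat" where
  "reg_sum r L = (\<Sum>i\<leftarrow>L. r i)"

lemma reg_sum_cong: "(\<And>i. i \<in> set L \<Longrightarrow> r i = r' i) \<Longrightarrow> reg_sum r L = reg_sum r' L"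
  unfolding reg_sum_def by (intro arg_cong[where f = sum_list]) auto

lemma run_Add_list:
  "t \<notin> set L \<Longrightarrow> run (map (Add t t) L) (r, m) = (r(t := r t + reg_sum r L), m)"
proof (induction L arbitrary: r)
  case Nil
  then show ?case by (simp add: reg_sum_def)
next
  case (Cons i L)
  let ?r = "r(t := r t + r i)"
  have "reg_sum ?r L = reg_sum r L"
    using Cons.prems by (intro reg_sum_cong) auto
  then have "run (map (Add t t) (i # L)) (r, m) = (?r(t := ?r t + reg_sum r L), m)"
    using Cons.IH[of ?r] Cons.prems by (simp del: fun_upd_apply)
  then show ?case by (simp add: reg_sum_def fun_upd_def add.assoc cong: if_cong)
qed

text \<open>With truncated subtraction the two differences add up to the distance between both
  sides, which is zero exactly if the constraint holds.\<close>

definition check_code :: "nat \<times> nat list \<Rightarrow> instr list" where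
  "check_code = (\<lambda>(j, L). Const 4 0 # map (Add 4 4) L @
     [Sub 5 4 (7 + j), Sub 6 (7 + j) 4, Add 3 3 5, Add 3 3 6])"

definition feasible :: "(nat \<Rightarrow> nat) \<Rightarrow> (nat \<times> nat list) list \<Rightarrow> bool" where
  "feasible r cs \<longleftrightarrow> (\<forall>(j, L)\<in>set cs. reg_sum r L = r (7 + j))"

lemma feasible_cong:
  assumes "\<And>i. i \<notin> {0} \<union> scratch \<Longrightarrow> r i = r' i" "\<And>j L. (j, L) \<in> set cs \<Longrightarrow> set L \<inter> ({0} \<union> scratch) = {}"
  shows "feasible r cs = feasible r' cs"
proof -
  have "(reg_sum r L = r (7 + j)) = (reg_sum r' L = r' (7 + j))" if "(j, L) \<in> set cs" for j L
  proof -
    have "reg_sum r L = reg_sum r' L" using assms that by (intro reg_sum_cong) blast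
    moreover have "r (7 + j) = r' (7 + j)" by (rule assms) (simp add: scratch_def)
    ultimately show ?thesis by simp
  qed
  then show ?thesis unfolding feasible_def by blast
qed

lemma run_check_code:
  assumes "set L \<inter> scratch = {}"
  obtains r' where "run (check_code (j, L)) (r, m) = (r', m)" "\<And>i. i \<notin> scratch \<Longrightarrow> r' i = r i"
    "r' 3 = 0 \<longleftrightarrow> r 3 = 0 \<and> reg_sum r L = r (7 + j)"
proof -
  have "reg_sum (r(4 := 0)) L = reg_sum r L"
    using assms by (intro reg_sum_cong) (auto simp: scratch_def)
  moreover have "4 \<notin> set L" using assms by (auto simp: scratch_def)
  ultimately have "run (check_code (j, L)) (r, m) =
     (r(4 := reg_sum r L, 5 := reg_sum r L - r (7 + j), 6 := r (7 + j) - reg_sum r L,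
        3 := r 3 + (reg_sum r L - r (7 + j)) + (r (7 + j) - reg_sum r L)), m)"
    by (simp add: check_code_def run_Add_list fun_eq_iff)
  then show ?thesis by (rule that) (auto simp: scratch_def)
qed

lemma run_check_codes:
  assumes "\<And>j L. (j, L) \<in> set cs \<Longrightarrow> set L \<inter> ({0} \<union> scratch) = {}"
  shows "\<exists>r'. run (concat (map check_code cs)) (r, m) = (r', m) \<and>
    (\<forall>i. i \<notin> scratch \<longrightarrow> r' i = r i) \<and> (r' 3 = 0 \<longleftrightarrow> r 3 = 0 \<and> feasible r cs)"
  using assms
proof (induction cs arbitrary: r)
  case Nil
  then show ?case by (simp add: feasible_def)
next
  case (Cons c cs)
  obtain j L where c: "c = (j, L)" by fastforce
  obtain r1 where r1: "run (check_code c) (r, m) = (r1, m)" "\<And>i. i \<notin> scratch \<Longrightarrow> r1 i = r i"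
    "r1 3 = 0 \<longleftrightarrow> r 3 = 0 \<and> reg_sum r L = r (7 + j)"
    using run_check_code[of L j r m] Cons.prems[of j L] unfolding c by auto
  obtain r2 where r2: "run (concat (map check_code cs)) (r1, m) = (r2, m)"
    "\<And>i. i \<notin> scratch \<Longrightarrow> r2 i = r1 i" "r2 3 = 0 \<longleftrightarrow> r1 3 = 0 \<and> feasible r1 cs"
    using Cons.IH[of r1] Cons.prems by (meson list.set_intros(2))
  have "feasible r1 cs = feasible r cs"
    using r1(2) Cons.prems by (intro feasible_cong) auto
  then have "r2 3 = 0 \<longleftrightarrow> r 3 = 0 \<and> feasible r (c # cs)"
    using r1(3) r2(3) by (auto simp: feasible_def c)
  with r1 r2 show ?case by (intro exI[of _ r2]) auto
qed

text \<open>The registers in \<open>A\<close> are frozen at \<open>\<rho>\<close>. The prospective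
  optimum \<open>y\<close> bounds register 0 from below, and the ghost flag \<open>q\<close> records
  that it has been reached.\<close>

definition best_inv :: "nat set \<Rightarrow> (nat \<Rightarrow> nat) \<Rightarrow> nat \<Rightarrow> bool \<Rightarrow> store \<Rightarrow> bool" where
  "best_inv A \<rho> y q = (\<lambda>(r, m). (\<forall>i\<in>A. r i = \<rho> i) \<and> y \<le> r 0 \<and> (q \<longrightarrow> r 0 = y))"

text \<open>
  Register 3 accumulates the violation of the constraints. The loop runs once if it vanishes
  and not at all otherwise; \<open>x - (x - y)\<close> is the minimum of \<open>x\<close> and \<open>y\<close>.
\<close>

definition candidate :: "(nat \<times> nat list) list \<times> nat list \<Rightarrow> com" where
  "candidate = (\<lambda>(cs, L). Seq
     (Block (Const 3 0 # concat (map check_code cs) @ Const 4 0 # map (Add 4 4) L @ [Sub 5 2 3]))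
     (While 5 (Block [Sub 6 0 4, Sub 0 0 6, Sub 5 5 2])))"

lemma straight_check_code: "i \<in> set (check_code c) \<Longrightarrow> straight i"
  by (cases c) (auto simp: check_code_def)

text \<open>\<open>T\<close> is obtained before the valuation and the flag because the time bound
  depends on the code alone; the loops around it need a uniform bound.\<close>

lemma triple_candidate:
  obtains T where "\<And>A \<rho> y q. A \<inter> ({0} \<union> scratch) = {} \<Longrightarrow> 2 \<in> A \<Longrightarrow> \<rho> 2 = 1 \<Longrightarrow> set L \<subseteq> A \<Longrightarrow>
     (\<And>j K. (j, K) \<in> set cs \<Longrightarrow> set K \<subseteq> A \<and> 7 + j \<in> A) \<Longrightarrow>
     (feasible \<rho> cs \<Longrightarrow> y \<le> reg_sum \<rho> L) \<Longrightarrow>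
     triple T (best_inv A \<rho> y q) (candidate (cs, L))
       (best_inv A \<rho> y (q \<or> feasible \<rho> cs \<and> reg_sum \<rho> L = y))"
proof -
  let ?is = "Const 3 0 # concat (map check_code cs) @ Const 4 0 # map (Add 4 4) L @ [Sub 5 2 3]"
  let ?js = "[Sub 6 0 4, Sub 0 0 6, Sub 5 5 2]"
  show ?thesis
  proof (rule that)
    fix A \<rho> y q
    assume A: "A \<inter> ({0} \<union> scratch) = {}" "2 \<in> A" and \<rho>: "\<rho> 2 = 1" and L: "set L \<subseteq> A"
      and cs: "\<And>j K. (j, K) \<in> set cs \<Longrightarrow> set K \<subseteq> A \<and> 7 + j \<in> A"
      and y: "feasible \<rho> cs \<Longrightarrow> y \<le> reg_sum \<rho> L"
    let ?q' = "q \<or> feasible \<rho> cs \<and> reg_sum \<rho> L = y"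
    define k :: nat where "k = (if feasible \<rho> cs then 1 else 0)"
    \<comment> \<open>The new flag is claimed only once the update loop is over. If \<open>k\<close>
      is 0, the assignment is infeasible and both flags agree.\<close>
    define J where "J j = (\<lambda>(r, m). r 5 = j \<and> r 4 = reg_sum \<rho> L \<and> j \<le> k \<and>
       best_inv A \<rho> y (if j = 0 then ?q' else q) (r, m))" for j :: nat
    have "triple (length ?is) (best_inv A \<rho> y q) (Block ?is) (J k)"
    proof (rule triple_Block)
      show "\<forall>i\<in>set ?is. straight i" using straight_check_code by auto
    next
      fix r m assume I: "best_inv A \<rho> y q (r, m)"
      have dis: "set K \<inter> ({0} \<union> scratch) = {}" if "(j, K) \<in> set cs" for j K
        using cs[OF that] A by blast
      obtain r' where r': "run (concat (map check_code cs)) (r(3 := 0), m) = (r', m)"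
        "\<And>i. i \<notin> scratch \<Longrightarrow> r' i = (r(3 := 0)) i"
        "r' 3 = 0 \<longleftrightarrow> (r(3 := 0)) 3 = 0 \<and> feasible (r(3 := 0)) cs"
        using run_check_codes[of cs "r(3 := 0)" m] dis by (metis (no_types, lifting))
      have agree: "r' i = \<rho> i" if "i \<in> A" for i
        using that r'(2)[of i] A I by (auto simp: best_inv_def scratch_def)
      have "feasible (r(3 := 0)) cs = feasible \<rho> cs"
      proof -
        have "reg_sum (r(3 := 0)) K = reg_sum \<rho> K \<and> (r(3 := 0)) (7 + j) = \<rho> (7 + j)"
          if "(j, K) \<in> set cs" for j K
          using cs[OF that] I A by (auto simp: best_inv_def scratch_def intro!: reg_sum_cong)
        then show ?thesis unfolding feasible_def by fastforce
      qed
      then have f: "r' 3 = 0 \<longleftrightarrow> feasible \<rho> cs" using r'(3) by simp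
      have "4 \<notin> set L" using L A by (auto simp: scratch_def)
      moreover have "reg_sum (r'(4 := 0)) L = reg_sum \<rho> L"
        using L A agree by (intro reg_sum_cong) (auto simp: scratch_def)
      ultimately have run: "run ?is (r, m) = (r'(4 := reg_sum \<rho> L, 5 := 1 - r' 3), m)"
        using r'(1) agree[OF A(2)] \<rho> by (simp add: run_Add_list)
      have "r' 0 = r 0" using r'(2)[of 0] by (simp add: scratch_def)
      then show "J k (run ?is (r, m))" unfolding run J_def
        using I agree f A by (auto simp: best_inv_def scratch_def k_def)
    qed
    moreover have "triple (k * (length ?js + 2) + 1) (J k) (While 5 (Block ?js)) (J 0)"
    proof (rule triple_While)
      fix j assume "j < k"
      then have [simp]: "j = 0" "k = 1" and feas: "feasible \<rho> cs"
        by (auto simp: k_def split: if_splits)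
      show "triple (length ?js) (J (Suc j)) (Block ?js) (J j)"
      proof (rule triple_Block)
        fix r m assume "J (Suc j) (r, m)"
        then show "J j (run ?js (r, m))"
          using A \<rho> y[OF feas] feas
          by (auto simp: J_def best_inv_def scratch_def)
      qed auto
    qed (auto simp: J_def)
    ultimately have "triple (length ?is + (k * (length ?js + 2) + 1)) (best_inv A \<rho> y q)
        (candidate (cs, L)) (J 0)"
      unfolding candidate_def prod.case by (rule triple_Seq)
    then show "triple (length ?is + (length ?js + 3)) (best_inv A \<rho> y q) (candidate (cs, L))
        (best_inv A \<rho> y ?q')"
      by (rule triple_conseq) (auto simp: J_def k_def)
  qed
qed

primrec candidates :: "((nat \<times> nat list) list \<times> nat list) list \<Rightarrow> com" where
  "candidates [] = Block []"
| "candidates (b # bs) = Seq (candidate b) (candidates bs)"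

lemma triple_candidates:
  obtains T where "\<And>A \<rho> y q. A \<inter> ({0} \<union> scratch) = {} \<Longrightarrow> 2 \<in> A \<Longrightarrow> \<rho> 2 = 1 \<Longrightarrow>
     (\<And>cs L. (cs, L) \<in> set bs \<Longrightarrow> set L \<subseteq> A) \<Longrightarrow>
     (\<And>cs L j K. (cs, L) \<in> set bs \<Longrightarrow> (j, K) \<in> set cs \<Longrightarrow> set K \<subseteq> A \<and> 7 + j \<in> A) \<Longrightarrow>
     (\<And>cs L. (cs, L) \<in> set bs \<Longrightarrow> feasible \<rho> cs \<Longrightarrow> y \<le> reg_sum \<rho> L) \<Longrightarrow>
     triple T (best_inv A \<rho> y q) (candidates bs)
       (best_inv A \<rho> y (q \<or> (\<exists>(cs, L)\<in>set bs. feasible \<rho> cs \<and> reg_sum \<rho> L = y)))"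
proof (induction bs arbitrary: thesis)
  case Nil
  have "triple 0 (best_inv A \<rho> y q) (candidates []) (best_inv A \<rho> y q)" for A \<rho> y q
    using triple_Block[of "[]" "best_inv A \<rho> y q" "best_inv A \<rho> y q"] by simp
  then show ?case by (intro Nil[of 0]) simp
next
  case (Cons b bs)
  obtain cs L where b: "b = (cs, L)" by fastforce
  obtain T1 where T1: "\<And>A \<rho> y q. A \<inter> ({0} \<union> scratch) = {} \<Longrightarrow> 2 \<in> A \<Longrightarrow> \<rho> 2 = 1 \<Longrightarrow> set L \<subseteq> A \<Longrightarrow>
     (\<And>j K. (j, K) \<in> set cs \<Longrightarrow> set K \<subseteq> A \<and> 7 + j \<in> A) \<Longrightarrow>
     (feasible \<rho> cs \<Longrightarrow> y \<le> reg_sum \<rho> L) \<Longrightarrow>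
     triple T1 (best_inv A \<rho> y q) (candidate (cs, L))
       (best_inv A \<rho> y (q \<or> feasible \<rho> cs \<and> reg_sum \<rho> L = y))"
    using triple_candidate[of L cs] by blast
  obtain T2 where T2: "\<And>A \<rho> y q. A \<inter> ({0} \<union> scratch) = {} \<Longrightarrow> 2 \<in> A \<Longrightarrow> \<rho> 2 = 1 \<Longrightarrow>
     (\<And>cs L. (cs, L) \<in> set bs \<Longrightarrow> set L \<subseteq> A) \<Longrightarrow>
     (\<And>cs L j K. (cs, L) \<in> set bs \<Longrightarrow> (j, K) \<in> set cs \<Longrightarrow> set K \<subseteq> A \<and> 7 + j \<in> A) \<Longrightarrow>
     (\<And>cs L. (cs, L) \<in> set bs \<Longrightarrow> feasible \<rho> cs \<Longrightarrow> y \<le> reg_sum \<rho> L) \<Longrightarrow>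
     triple T2 (best_inv A \<rho> y q) (candidates bs)
       (best_inv A \<rho> y (q \<or> (\<exists>(cs, L)\<in>set bs. feasible \<rho> cs \<and> reg_sum \<rho> L = y)))"
    using Cons.IH by blast
  show ?case
  proof (rule Cons.prems)
    fix A \<rho> y q
    assume A: "A \<inter> ({0} \<union> scratch) = {}" "2 \<in> A" "\<rho> 2 = 1"
      and L: "\<And>cs L. (cs, L) \<in> set (b # bs) \<Longrightarrow> set L \<subseteq> A"
      and K: "\<And>cs L j K. (cs, L) \<in> set (b # bs) \<Longrightarrow> (j, K) \<in> set cs \<Longrightarrow> set K \<subseteq> A \<and> 7 + j \<in> A"
      and y: "\<And>cs L. (cs, L) \<in> set (b # bs) \<Longrightarrow> feasible \<rho> cs \<Longrightarrow> y \<le> reg_sum \<rho> L"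
    let ?q' = "q \<or> feasible \<rho> cs \<and> reg_sum \<rho> L = y"
    have "triple T1 (best_inv A \<rho> y q) (candidate (cs, L)) (best_inv A \<rho> y ?q')"
      using L[of cs L] K[of cs L] y[of cs L] b by (intro T1 A) simp_all
    moreover have "triple T2 (best_inv A \<rho> y ?q') (candidates bs)
       (best_inv A \<rho> y (?q' \<or> (\<exists>(cs, L)\<in>set bs. feasible \<rho> cs \<and> reg_sum \<rho> L = y)))"
    proof (rule T2)
      show "A \<inter> ({0} \<union> scratch) = {}" "2 \<in> A" "\<rho> 2 = 1" by (fact A)+
      show "set L \<subseteq> A" if "(cs, L) \<in> set bs" for cs L using that L[of cs L] by simp
      show "set K' \<subseteq> A \<and> 7 + j \<in> A" if "(cs, L) \<in> set bs" "(j, K') \<in> set cs" for cs L j K'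
        using that K[of cs L j K'] by simp
      show "y \<le> reg_sum \<rho> L" if "(cs, L) \<in> set bs" "feasible \<rho> cs" for cs L
        using that y[of cs L] by simp
    qed
    ultimately have "triple (T1 + T2) (best_inv A \<rho> y q) (candidates (b # bs))
       (best_inv A \<rho> y (?q' \<or> (\<exists>(cs, L)\<in>set bs. feasible \<rho> cs \<and> reg_sum \<rho> L = y)))"
      unfolding b candidates.simps by (rule triple_Seq)
    then show "triple (T1 + T2) (best_inv A \<rho> y q) (candidates (b # bs))
       (best_inv A \<rho> y (q \<or> (\<exists>(cs, L)\<in>set (b # bs). feasible \<rho> cs \<and> reg_sum \<rho> L = y)))"
      by (rule triple_conseq) (auto simp: b best_inv_def)
  qed
qed

section \<open>Nested loops over all assignments\<close>

text \<open>
  In the loop register \<open>i\<close> takes the values \<open>n, \<dots>, 1\<close>; the trailing copy of the body handles 0.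
\<close>

primrec nest :: "nat list \<Rightarrow> com \<Rightarrow> com" where
  "nest [] c = c"
| "nest (i # is) c = Seq (Block [Const i 0, Add i i 1])
     (Seq (While i (Seq (nest is c) (Block [Sub i i 2]))) (nest is c))"

text \<open>\<open>[:0, 1:]\<close> is the bound \<open>n\<close> of the loops. The outer 3 pays for
  two initial instructions and the last test, the inner 3 for test, decrement and jump in each
  round.\<close>

primrec nest_time :: "nat list \<Rightarrow> nat poly \<Rightarrow> nat poly" where
  "nest_time [] p = p"
| "nest_time (i # is) p = [:3:] + [:0, 1:] * (nest_time is p + [:3:]) + nest_time is p"

text \<open>The assignment \<open>\<omega>\<close> is a target that the search must meet: the flag
  is set when the body runs on it. \<open>G\<close> depends only on the registers in
  \<open>C\<close>, which no loop changes, and so holds in every round.\<close>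

lemma triple_nest:
  assumes "distinct is" "A \<inter> set is = {}" "0 \<notin> A \<union> set is" "{1, 2} \<subseteq> C" "C \<subseteq> A"
    and "\<forall>i\<in>set is. \<omega> i \<le> n"
    and C: "\<And>\<rho>. G \<rho> \<Longrightarrow> \<rho> 1 = n \<and> \<rho> 2 = 1"
      "\<And>\<rho> \<rho>'. (\<And>i. i \<in> C \<Longrightarrow> \<rho> i = \<rho>' i) \<Longrightarrow> G \<rho> \<Longrightarrow> G \<rho>'"
    and body: "\<And>\<rho> q. G \<rho> \<Longrightarrow> triple (poly p n) (best_inv (A \<union> set is) \<rho> y q) c
      (best_inv (A \<union> set is) \<rho> y (q \<or> (\<forall>i\<in>A \<union> set is. \<rho> i = \<omega> i)))"
    and "G \<rho>"
  shows "triple (poly (nest_time is p) n) (best_inv A \<rho> y q) (nest is c)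
    (best_inv A \<rho> y (q \<or> (\<forall>i\<in>A. \<rho> i = \<omega> i)))"
  using assms(1-6) body assms(10)
proof (induction "is" arbitrary: A \<rho> q)
  case Nil
  then show ?case by simp
next
  case (Cons i "is")
  let ?A = "insert i A" and ?T = "poly (nest_time is p) n"
  have ins: "A \<union> set (i # is) = ?A \<union> set is" by auto
  have i: "i \<notin> A" "i \<noteq> 0" "i \<noteq> 1" "i \<noteq> 2" "\<omega> i \<le> n" "i \<notin> C" using Cons.prems by auto
  have G: "G (\<rho>(i := j))" for j
    by (rule C(2)[OF _ Cons.prems(8)]) (use i in auto)
  have IH: "triple ?T (best_inv ?A (\<rho>(i := j)) y q') (nest is c)
      (best_inv ?A (\<rho>(i := j)) y (q' \<or> (\<forall>k\<in>A. \<rho> k = \<omega> k) \<and> j = \<omega> i))" for j q'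
  proof -
    have *: "(\<forall>k\<in>?A. (\<rho>(i := j)) k = \<omega> k) \<longleftrightarrow> (\<forall>k\<in>A. \<rho> k = \<omega> k) \<and> j = \<omega> i"
      using i by auto
    show ?thesis unfolding *[symmetric]
    proof (rule Cons.IH)
      show "triple (poly p n) (best_inv (?A \<union> set is) \<rho>' y q) c
          (best_inv (?A \<union> set is) \<rho>' y (q \<or> (\<forall>i\<in>?A \<union> set is. \<rho>' i = \<omega> i)))"
        if "G \<rho>'" for \<rho>' q
        using Cons.prems(7)[OF that, of q] unfolding ins .
      show "G (\<rho>(i := j))" by (rule G)
    qed (use Cons.prems(1-6) in auto)
  qed
  \<comment> \<open>When register \<open>i\<close> holds \<open>j\<close>, all larger values have
    been tried. Initially \<open>j\<close> is \<open>n\<close>, and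
    \<open>\<omega> i \<le> n\<close> leaves the flag as it was.\<close>
  define J where "J j = best_inv ?A (\<rho>(i := j)) y (q \<or> (\<forall>k\<in>A. \<rho> k = \<omega> k) \<and> \<omega> i > j)" for j
  have 1: "triple (length [Const i 0, Add i i 1]) (best_inv A \<rho> y q) (Block [Const i 0, Add i i 1]) (J n)"
  proof (rule triple_Block)
    fix r m assume "best_inv A \<rho> y q (r, m)"
    then show "J n (run [Const i 0, Add i i 1] (r, m))"
      using Cons.prems(4,5,8) C(1)[of \<rho>] i by (auto simp: best_inv_def J_def)
  qed auto
  have 2: "triple (n * (?T + 1 + 2) + 1) (J n) (While i (Seq (nest is c) (Block [Sub i i 2]))) (J 0)"
  proof (rule triple_While)
    fix j assume "j < n"
    let ?J' = "best_inv ?A (\<rho>(i := Suc j)) y (q \<or> (\<forall>k\<in>A. \<rho> k = \<omega> k) \<and> \<omega> i > j)"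
    have "triple ?T (J (Suc j)) (nest is c) ?J'"
      unfolding J_def
      by (rule triple_conseq[OF IH[of "Suc j" "q \<or> (\<forall>k\<in>A. \<rho> k = \<omega> k) \<and> \<omega> i > Suc j"]])
        (auto simp: best_inv_def)
    moreover have "triple (length [Sub i i 2]) ?J' (Block [Sub i i 2]) (J j)"
    proof (rule triple_Block)
      fix r m assume "?J' (r, m)"
      moreover have "2 \<in> A" using Cons.prems by auto
      ultimately show "J j (run [Sub i i 2] (r, m))"
        using C(1)[OF Cons.prems(8)] i by (auto simp: best_inv_def J_def)
    qed auto
    ultimately show "triple (?T + 1) (J (Suc j)) (Seq (nest is c) (Block [Sub i i 2])) (J j)"
      by (intro triple_Seq) auto
  qed (auto simp: J_def best_inv_def)
  \<comment> \<open>The value 0 is the only one left for \<open>\<omega> i\<close>.\<close>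
  have 3: "triple ?T (J 0) (nest is c) (best_inv A \<rho> y (q \<or> (\<forall>i\<in>A. \<rho> i = \<omega> i)))"
    unfolding J_def
    by (rule triple_conseq[OF IH[of 0 "q \<or> (\<forall>k\<in>A. \<rho> k = \<omega> k) \<and> \<omega> i > 0"]]) (use i in \<open>auto simp: best_inv_def\<close>)
  show ?case
    using triple_Seq[OF 1 triple_Seq[OF 2 3]] by (auto elim!: triple_conseq simp: algebra_simps)
qed

section \<open>Counting the entries of the input\<close>

definition count_inv :: "nat list \<Rightarrow> nat set \<Rightarrow> store \<Rightarrow> bool" where
  "count_inv d J = (\<lambda>(r, m). r 0 = length d \<and> r 1 = length d \<and> r 2 = 1 \<and>
     (\<forall>a<length d. m a = d ! a) \<and> (\<forall>j\<in>J. r (7 + j) = count_list d j))"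

text \<open>
  At the start of each round register 3 holds the number of entries still to be read; register 6
  becomes 1 if the entry in register 4 equals \<open>j\<close>, and 0 otherwise.
\<close>

definition count_com :: "nat \<Rightarrow> com" where
  "count_com j = Seq (Block [Const (7 + j) 0, Const 3 0, Add 3 3 1])
     (While 3 (Block [Sub 4 3 2, Load 4 4, Const 5 j, Sub 6 4 5, Sub 5 5 4, Add 6 6 5, Sub 6 2 6,
        Add (7 + j) (7 + j) 6, Sub 3 3 2]))"

lemma triple_count_com:
  "triple (12 * length d + 4) (count_inv d J) (count_com j) (count_inv d (insert j J))"
proof -
  let ?n = "length d"
  let ?is = "[Const (7 + j) 0, Const 3 0, Add 3 3 1]"
  let ?js = "[Sub 4 3 2, Load 4 4, Const 5 j, Sub 6 4 5, Sub 5 5 4, Add 6 6 5, Sub 6 2 6,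
        Add (7 + j) (7 + j) 6, Sub 3 3 2]"
  \<comment> \<open>The entries are read from the last to the first, so the counter refers to
    \<open>drop a d\<close>. Removing \<open>j\<close> from \<open>J\<close> allows its register to
    be overwritten even if it was already counted.\<close>
  define K where "K a = (\<lambda>(r, m). count_inv d (J - {j}) (r, m) \<and> a \<le> ?n \<and> r 3 = a \<and>
    r (7 + j) = count_list (drop a d) j)" for a
  have "triple (length ?is) (count_inv d J) (Block ?is) (K ?n)"
    by (rule triple_Block) (auto simp: count_inv_def K_def)
  moreover have "triple (?n * (length ?js + 2) + 1) (K ?n) (While 3 (Block ?js)) (K 0)"
  proof (rule triple_While)
    fix a assume a: "a < ?n"
    show "triple (length ?js) (K (Suc a)) (Block ?js) (K a)"
    proof (rule triple_Block)
      fix r m assume "K (Suc a) (r, m)"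
      moreover have "drop a d = d ! a # drop (Suc a) d" using a by (simp add: Cons_nth_drop_Suc)
      ultimately show "K a (run ?js (r, m))"
        using a by (auto simp: count_inv_def K_def)
    qed auto
  qed (auto simp: K_def)
  ultimately have "triple (length ?is + (?n * (length ?js + 2) + 1)) (count_inv d J) (count_com j) (K 0)"
    unfolding count_com_def by (rule triple_Seq)
  then show ?thesis
    by (rule triple_conseq) (auto simp: K_def count_inv_def)
qed

primrec count_all :: "nat \<Rightarrow> com" where
  "count_all 0 = Block [Const 2 1, Const 1 0, Add 1 1 0]"
| "count_all (Suc j) = Seq (count_all j) (count_com j)"

lemma triple_count_all:
  "triple (3 + k * (12 * length d + 4)) (\<lambda>s. s = snd (initial d)) (count_all k) (count_inv d {..<k})"
proof (induction k)
  case 0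
  have "triple (length [Const 2 1, Const 1 0, Add 1 1 0]) (\<lambda>s. s = snd (initial d))
      (count_all 0) (count_inv d {..<0})"
    unfolding count_all.simps
    by (rule triple_Block) (auto simp: initial_def count_inv_def)
  then show ?case by (rule triple_conseq) simp_all
next
  case (Suc k)
  show ?case unfolding count_all.simps
    by (rule triple_conseq[OF triple_Seq[OF Suc triple_count_com[of d "{..<k}"]]])
      (auto simp: lessThan_Suc)
qed

section \<open>A machine for a family of integer linear programs\<close>

text \<open>
  The premises on \<open>y\<close> say that it is the optimum of a family of integer linear programs, attained
  within the range of the exhaustive search.
\<close>

lemma linear_programs_machine:
  fixes bs :: "((nat \<Rightarrow> nat) \<times> nat) list" and \<alpha> :: "nat \<Rightarrow> nat \<Rightarrow> nat" and \<tau> :: "nat \<Rightarrow> nat"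
  shows "\<exists>(P :: program) (p :: nat poly). \<forall>(d :: nat list) y. y \<le> length d \<longrightarrow>
    (\<forall>(\<beta>, \<sigma>)\<in>set bs. \<forall>x. (\<forall>j\<le>\<Delta>. \<beta> j + (\<Sum>l<m. \<alpha> l j * x l) = count_list d j) \<longrightarrow>
       y \<le> \<sigma> + (\<Sum>l<m. \<tau> l * x l)) \<longrightarrow>
    (\<exists>(\<beta>, \<sigma>)\<in>set bs. \<exists>x. (\<forall>l<m. x l \<le> length d) \<and>
       (\<forall>j\<le>\<Delta>. \<beta> j + (\<Sum>l<m. \<alpha> l j * x l) = count_list d j) \<and> y = \<sigma> + (\<Sum>l<m. \<tau> l * x l)) \<longrightarrow>
    outputs_within P d y (poly p (length d))"
proof -
  \<comment> \<open>The first register after the counters \<open>7, \<dots>, 7 + \<Delta>\<close>;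
    variable \<open>l\<close> lives in register \<open>off + l\<close>.\<close>
  define off where "off = 8 + \<Delta>"
  define form where "form c f = replicate c 2 @ concat (map (\<lambda>l. replicate (f l) (off + l)) [0..<m])"
    for c :: nat and f :: "nat \<Rightarrow> nat"
  define bs' where "bs' = map (\<lambda>(\<beta>, \<sigma>). (map (\<lambda>j. (j, form (\<beta> j) (\<lambda>l. \<alpha> l j))) [0..<Suc \<Delta>],
    form \<sigma> \<tau>)) bs"
  define js where "js = [off..<off + m]"
  \<comment> \<open>The registers that stay constant during the search.\<close>
  define C where "C = {1, 2} \<union> (\<lambda>j. 7 + j) ` {..\<Delta>}"
  have sum_form: "reg_sum r (form c f) = c * r 2 + (\<Sum>l<m. f l * r (off + l))" for r c f
  proof -
    have "sum_list (map r (concat (map (\<lambda>l. replicate (f l) (off + l)) ls)))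
        = (\<Sum>l\<leftarrow>ls. f l * r (off + l))" for ls
      by (induction ls) (auto simp: sum_list_replicate)
    then show ?thesis
      by (simp add: reg_sum_def form_def sum_list_replicate sum_list_distinct_conv_sum_set
          atLeast0LessThan)
  qed
  have set_form: "set (form c f) \<subseteq> C \<union> set js" for c f
    by (auto simp: form_def C_def js_def)
  obtain T where T: "\<And>A \<rho> y q. A \<inter> ({0} \<union> scratch) = {} \<Longrightarrow> 2 \<in> A \<Longrightarrow> \<rho> 2 = 1 \<Longrightarrow>
     (\<And>cs L. (cs, L) \<in> set bs' \<Longrightarrow> set L \<subseteq> A) \<Longrightarrow>
     (\<And>cs L j K. (cs, L) \<in> set bs' \<Longrightarrow> (j, K) \<in> set cs \<Longrightarrow> set K \<subseteq> A \<and> 7 + j \<in> A) \<Longrightarrow>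
     (\<And>cs L. (cs, L) \<in> set bs' \<Longrightarrow> feasible \<rho> cs \<Longrightarrow> y \<le> reg_sum \<rho> L) \<Longrightarrow>
     triple T (best_inv A \<rho> y q) (candidates bs')
       (best_inv A \<rho> y (q \<or> (\<exists>(cs, L)\<in>set bs'. feasible \<rho> cs \<and> reg_sum \<rho> L = y)))"
    using triple_candidates[of bs'] by blast
  define c where "c = Seq (count_all (Suc \<Delta>)) (nest js (candidates bs'))"
  define p where "p = [:3:] + [:Suc \<Delta>:] * [:4, 12:] + nest_time js [:T:]"
  show ?thesis
  proof (intro exI allI impI)
    fix d :: "nat list" and y
    let ?n = "length d"
    assume y: "y \<le> ?n"
      and lower: "\<forall>(\<beta>, \<sigma>)\<in>set bs. \<forall>x. (\<forall>j\<le>\<Delta>. \<beta> j + (\<Sum>l<m. \<alpha> l j * x l) = count_list d j) \<longrightarrow>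
        y \<le> \<sigma> + (\<Sum>l<m. \<tau> l * x l)"
      and "\<exists>(\<beta>, \<sigma>)\<in>set bs. \<exists>x. (\<forall>l<m. x l \<le> ?n) \<and>
        (\<forall>j\<le>\<Delta>. \<beta> j + (\<Sum>l<m. \<alpha> l j * x l) = count_list d j) \<and> y = \<sigma> + (\<Sum>l<m. \<tau> l * x l)"
    then obtain \<beta> \<sigma> x where opt: "(\<beta>, \<sigma>) \<in> set bs" "\<forall>l<m. x l \<le> ?n"
      "\<forall>j\<le>\<Delta>. \<beta> j + (\<Sum>l<m. \<alpha> l j * x l) = count_list d j" "y = \<sigma> + (\<Sum>l<m. \<tau> l * x l)"
      by blast
    \<comment> \<open>The target of the search: the input data together with the optimal solution
      \<open>x\<close>.\<close>
    define \<omega> where "\<omega> i = (if i = 1 then ?n else if i = 2 then 1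
      else if i < off then count_list d (i - 7) else x (i - off))" for i
    define G where "G \<rho> \<longleftrightarrow> (\<forall>i\<in>C. \<rho> i = \<omega> i)" for \<rho>
    have GD: "\<rho> 1 = ?n \<and> \<rho> 2 = 1 \<and> (\<forall>j\<le>\<Delta>. \<rho> (7 + j) = count_list d j)" if "G \<rho>" for \<rho>
      using that by (auto simp: G_def C_def \<omega>_def off_def)
    have feas: "feasible \<rho> (map (\<lambda>j. (j, form (\<beta> j) (\<lambda>l. \<alpha> l j))) [0..<Suc \<Delta>]) \<longleftrightarrow>
        (\<forall>j\<le>\<Delta>. \<beta> j + (\<Sum>l<m. \<alpha> l j * \<rho> (off + l)) = count_list d j)" if "G \<rho>" for \<rho> \<beta>
      using GD[OF that] by (auto simp: feasible_def sum_form less_Suc_eq_le simp del: upt_Suc)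
    have body: "triple (poly [:T:] ?n) (best_inv (C \<union> set js) \<rho> y q) (candidates bs')
        (best_inv (C \<union> set js) \<rho> y (q \<or> (\<forall>i\<in>C \<union> set js. \<rho> i = \<omega> i)))" if G: "G \<rho>" for \<rho> q
    proof (rule triple_conseq[OF T])
      show "(C \<union> set js) \<inter> ({0} \<union> scratch) = {}" "2 \<in> C \<union> set js"
        by (auto simp: C_def js_def off_def scratch_def)
      show "\<rho> 2 = 1" using GD[OF G] by simp
      show "set L \<subseteq> C \<union> set js" if "(cs, L) \<in> set bs'" for cs L
        using that set_form by (auto simp: bs'_def)
      show "set K \<subseteq> C \<union> set js \<and> 7 + j \<in> C \<union> set js"
        if mem: "(cs, L) \<in> set bs'" "(j, K) \<in> set cs" for cs L j K
      proof -
        obtain \<beta> where "cs = map (\<lambda>j. (j, form (\<beta> j) (\<lambda>l. \<alpha> l j))) [0..<Suc \<Delta>]"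
          using mem(1) by (auto simp: bs'_def simp del: upt_Suc)
        then have "K = form (\<beta> j) (\<lambda>l. \<alpha> l j)" "j < Suc \<Delta>"
          using mem(2) by (auto simp del: upt_Suc)
        then show ?thesis using set_form[of "\<beta> j" "\<lambda>l. \<alpha> l j"] by (auto simp: C_def)
      qed
      show "y \<le> reg_sum \<rho> L" if mem: "(cs, L) \<in> set bs'" "feasible \<rho> cs" for cs L
      proof -
        obtain \<beta> \<sigma> where b: "(\<beta>, \<sigma>) \<in> set bs" "L = form \<sigma> \<tau>"
          "cs = map (\<lambda>j. (j, form (\<beta> j) (\<lambda>l. \<alpha> l j))) [0..<Suc \<Delta>]"
          using mem(1) by (auto simp: bs'_def simp del: upt_Suc)
        have "\<forall>j\<le>\<Delta>. \<beta> j + (\<Sum>l<m. \<alpha> l j * \<rho> (off + l)) = count_list d j"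
          using feas[OF G] mem(2) b(3) by simp
        then have "y \<le> \<sigma> + (\<Sum>l<m. \<tau> l * \<rho> (off + l))"
          using bspec[OF lower b(1), unfolded prod.case, rule_format, of "\<lambda>l. \<rho> (off + l)"] by blast
        then show ?thesis using GD[OF G] by (simp add: b(2) sum_form)
      qed
      \<comment> \<open>At the target the search variables hold \<open>x\<close>, so the program
        with data \<open>\<beta>\<close> and \<open>\<sigma>\<close> is feasible with value
        \<open>y\<close>.\<close>
      have "\<exists>(cs, L)\<in>set bs'. feasible \<rho> cs \<and> reg_sum \<rho> L = y"
        if agree: "\<forall>i\<in>C \<union> set js. \<rho> i = \<omega> i"
      proof -
        have "\<rho> (off + l) = x l" if "l < m" for l
          using agree that by (auto simp: js_def \<omega>_def off_def)
        then have eq: "(\<Sum>l<m. f l * \<rho> (off + l)) = (\<Sum>l<m. f l * x l)" for f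
          by (intro sum.cong) auto
        have "feasible \<rho> (map (\<lambda>j. (j, form (\<beta> j) (\<lambda>l. \<alpha> l j))) [0..<Suc \<Delta>])"
          unfolding feas[OF G] eq by (fact opt(3))
        moreover have "reg_sum \<rho> (form \<sigma> \<tau>) = y"
          using GD[OF G] opt(4) by (simp add: sum_form eq)
        ultimately show ?thesis using opt(1) by (force simp: bs'_def simp del: upt_Suc)
      qed
      then show "best_inv (C \<union> set js) \<rho> y (q \<or> (\<exists>(cs, L)\<in>set bs'. feasible \<rho> cs \<and> reg_sum \<rho> L = y)) s
          \<Longrightarrow> best_inv (C \<union> set js) \<rho> y (q \<or> (\<forall>i\<in>C \<union> set js. \<rho> i = \<omega> i)) s" for s
        unfolding best_inv_def by blast
    qed auto
    have "triple (poly (nest_time js [:T:]) ?n) (best_inv C \<omega> y False) (nest js (candidates bs'))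
        (best_inv C \<omega> y (False \<or> (\<forall>i\<in>C. \<omega> i = \<omega> i)))"
    proof (rule triple_nest[where G = G, OF _ _ _ _ _ _ _ _ body])
      show "\<forall>i\<in>set js. \<omega> i \<le> ?n" using opt(2) by (auto simp: js_def \<omega>_def off_def)
      show "\<rho> 1 = ?n \<and> \<rho> 2 = 1" if "G \<rho>" for \<rho> using GD[OF that] by simp
      show "G \<rho>'" if "\<And>i. i \<in> C \<Longrightarrow> \<rho> i = \<rho>' i" "G \<rho>" for \<rho> \<rho>'
        using that by (auto simp: G_def)
    qed (auto simp: js_def C_def off_def G_def)
    moreover have "triple (3 + Suc \<Delta> * (12 * ?n + 4)) (\<lambda>s. s = snd (initial d)) (count_all (Suc \<Delta>))
        (best_inv C \<omega> y False)"
    proof (rule triple_conseq[OF triple_count_all])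
      \<comment> \<open>Register 0 still holds the input length. Since
        \<open>y \<le> length d\<close>, this is a valid initial value for the minimum.\<close>
      show "count_inv d {..<Suc \<Delta>} s \<Longrightarrow> best_inv C \<omega> y False s" for s
        using y by (auto simp: count_inv_def best_inv_def C_def \<omega>_def off_def)
    qed auto
    ultimately have "triple (3 + Suc \<Delta> * (12 * ?n + 4) + poly (nest_time js [:T:]) ?n)
        (\<lambda>s. s = snd (initial d)) c (best_inv C \<omega> y (False \<or> (\<forall>i\<in>C. \<omega> i = \<omega> i)))"
      unfolding c_def by (intro triple_Seq)
    then have "triple (poly p ?n) (\<lambda>s. s = snd (initial d)) c (\<lambda>(r, m). r 0 = y)"
      by (rule triple_conseq) (auto simp: p_def best_inv_def algebra_simps)
    then show "outputs_within (compile c 0) d y (poly p ?n)"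
      by (rule triple_outputs) simp
  qed
qed

section \<open>The main theorem\<close>

theorem corollary2:
  fixes \<Delta> :: nat
  assumes "\<Delta> > 0"
  shows "\<exists>(P :: program) (p :: nat poly). \<forall>d.
           graphic d \<and> (\<forall>x \<in> set d. x \<le> \<Delta>)
             \<longrightarrow> outputs_within P d (gamma_min d) (poly p (length d))"
proof -
  define N :: nat where "N = fact (Suc \<Delta>)"
  define flat where "flat = pattern_mset \<Delta>"
  define total where "total x = (\<Sum>\<pi>\<in>patterns \<Delta>. x \<pi>)" for x :: "nat list \<Rightarrow> nat"
  \<comment> \<open>Numbering the patterns turns vectors indexed by patterns into register
    contents.\<close>
  obtain ps where ps: "distinct ps" "set ps = patterns \<Delta>"
    using finite_distinct_list[OF finite_patterns] by blast
  let ?m = "length ps"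
  have "bij_betw ((!) ps) {..<?m} (patterns \<Delta>)"
    using ps by (intro bij_betw_nth) auto
  then have sum_ps: "(\<Sum>l<?m. h (ps ! l)) = (\<Sum>\<pi>\<in>patterns \<Delta>. h \<pi>)" for h :: "nat list \<Rightarrow> nat"
    by (rule sum.reindex_bij_betw)
  have count_flat: "count (flat x) j = (\<Sum>l<?m. x (ps ! l) * count (mset (ps ! l)) j)" for x j
    unfolding sum_ps[of "\<lambda>\<pi>. x \<pi> * count (mset \<pi>) j"] by (simp add: flat_def pattern_mset_def count_sum)
  have total: "total x = (\<Sum>l<?m. x (ps ! l))" for x
    unfolding sum_ps total_def ..
  \<comment> \<open>No pattern has an entry above \<open>\<Delta>\<close>, so the equations for
    \<open>j \<le> \<Delta>\<close> determine the whole multiset.\<close>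
  have flat_le: "j \<le> \<Delta>" if mem: "j \<in># flat x" for x j
  proof -
    obtain \<pi> where "\<pi> \<in> patterns \<Delta>" "j \<in> set \<pi>"
      using mem unfolding flat_def pattern_mset_def set_mset_sum[OF finite_patterns]
      by (metis (no_types, lifting) UN_E count_greater_zero_iff count_repeat_mset mult_is_0 neq0_conv set_mset_mset)
    then show ?thesis by (auto simp: patterns_def)
  qed
  \<comment> \<open>Membership asks for some graph with the right degrees and a dominating set of
    size at most \<open>total x\<close>; its own patterns need not be counted by
    \<open>x\<close>.\<close>
  define A where "A = {x. dominable (flat x) (total x)}"
  have "N > 0" by (simp add: N_def)
  obtain B where B: "B \<subseteq> A" "finite B"
    "\<And>x. x \<in> A \<Longrightarrow> \<exists>b\<in>B. \<forall>\<pi>\<in>patterns \<Delta>. b \<pi> \<le> x \<pi> \<and> N dvd x \<pi> - b \<pi>"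
    using dickson_mod[OF finite_patterns \<open>N > 0\<close>, of A \<Delta>] by blast
  obtain bl where bl: "set bl = B" using finite_list[OF B(2)] by blast
  define bs where "bs = map (\<lambda>b. (count (flat b), total b)) bl"
  have closed: "dominable (flat (\<lambda>\<pi>. b \<pi> + N * y \<pi>)) (total (\<lambda>\<pi>. b \<pi> + N * y \<pi>))"
    if "b \<in> B" for b y
  proof -
    have "dominable (flat b + flat (\<lambda>\<pi>. N * y \<pi>)) (total b + total (\<lambda>\<pi>. N * y \<pi>))"
      using that B(1) dominable_pattern_mset_fact[of \<Delta> y]
      by (intro dominable_add) (auto simp: A_def flat_def total_def N_def)
    then show ?thesis
      by (simp add: flat_def total_def pattern_mset_add sum.distrib)
  qed
  have linear: "count (flat (\<lambda>\<pi>. b \<pi> + N * y \<pi>)) j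
      = count (flat b) j + (\<Sum>l<?m. (N * count (mset (ps ! l)) j) * y (ps ! l))"
    "total (\<lambda>\<pi>. b \<pi> + N * y \<pi>) = total b + (\<Sum>l<?m. N * y (ps ! l))" for b y j
    by (simp_all add: count_flat total sum.distrib algebra_simps)
  obtain P p where P: "\<forall>d y. y \<le> length d \<longrightarrow>
    (\<forall>(\<beta>, \<sigma>)\<in>set bs. \<forall>x. (\<forall>j\<le>\<Delta>. \<beta> j + (\<Sum>l<?m. (N * count (mset (ps ! l)) j) * x l) = count_list d j) \<longrightarrow>
       y \<le> \<sigma> + (\<Sum>l<?m. N * x l)) \<longrightarrow>
    (\<exists>(\<beta>, \<sigma>)\<in>set bs. \<exists>x. (\<forall>l<?m. x l \<le> length d) \<and>
       (\<forall>j\<le>\<Delta>. \<beta> j + (\<Sum>l<?m. (N * count (mset (ps ! l)) j) * x l) = count_list d j) \<and>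
       y = \<sigma> + (\<Sum>l<?m. N * x l)) \<longrightarrow>
    outputs_within P d y (poly p (length d))"
    using linear_programs_machine[where bs = bs and \<Delta> = \<Delta> and m = ?m
        and \<alpha> = "\<lambda>l j. N * count (mset (ps ! l)) j" and \<tau> = "\<lambda>_. N"] by blast
  show ?thesis
  proof (intro exI allI impI)
    fix d assume d: "graphic d \<and> (\<forall>x\<in>set d. x \<le> \<Delta>)"
    let ?n = "length d"
    obtain V E D where VED: "dominated_realization (V :: nat set) E D (mset d)" "card D = gamma_min d"
      using gamma_min_attained d by blast
    obtain x where x: "flat x = mset d" "total x = gamma_min d" "\<And>\<pi>. x \<pi> \<le> gamma_min d"
      using dominated_realization_patterns[OF VED(1), of \<Delta>] d unfolding flat_def total_def VED(2)
      by auto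
    have "dominable (mset d) (gamma_min d)"
      using VED unfolding dominable_def by (metis order_refl)
    then have "x \<in> A" by (simp add: A_def x)
    have le: "gamma_min d \<le> ?n"
    proof -
      have "finite V" "D \<subseteq> V" and M: "image_mset (vertex_degree E) (mset_set V) = mset d"
        using VED(1) by (auto simp: dominated_realization_def simple_graph_def dominating_set_def)
      moreover have "card V = ?n" using arg_cong[OF M, of size] by simp
      ultimately show ?thesis using VED(2) card_mono[of V D] by simp
    qed
    \<comment> \<open>Soundness: every solution of one of the programs yields a realization of
      \<open>d\<close> with a dominating set no larger than its value.\<close>
    have "gamma_min d \<le> \<sigma> + (\<Sum>l<?m. N * z l)"
      if mem: "(\<beta>, \<sigma>) \<in> set bs"
        and z: "\<forall>j\<le>\<Delta>. \<beta> j + (\<Sum>l<?m. (N * count (mset (ps ! l)) j) * z l) = count_list d j"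
      for \<beta> \<sigma> z
    proof -
      obtain b where b: "b \<in> B" "\<beta> = count (flat b)" "\<sigma> = total b"
        using mem bl by (auto simp: bs_def)
      \<comment> \<open>\<open>z\<close> is indexed by positions in \<open>ps\<close>; inverting the
        numbering gives a function on patterns.\<close>
      define y where "y = z \<circ> the_inv_into {..<?m} ((!) ps)"
      have y: "y (ps ! l) = z l" if "l < ?m" for l
        using that ps(1) by (simp add: y_def the_inv_into_f_f inj_on_nth)
      have "count (flat (\<lambda>\<pi>. b \<pi> + N * y \<pi>)) j = count (mset d) j" for j
      proof (cases "j \<le> \<Delta>")
        case True
        have "count (flat (\<lambda>\<pi>. b \<pi> + N * y \<pi>)) j
            = count (flat b) j + (\<Sum>l<?m. (N * count (mset (ps ! l)) j) * z l)"
          unfolding linear using y by simp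
        then show ?thesis using z True b(2) by (simp add: count_mset)
      next
        case False
        then have "j \<notin># flat (\<lambda>\<pi>. b \<pi> + N * y \<pi>)" "j \<notin># mset d" using flat_le d by auto
        then show ?thesis by (simp only: not_in_iff)
      qed
      then have "dominable (mset d) (total (\<lambda>\<pi>. b \<pi> + N * y \<pi>))"
        using closed[OF b(1), of y] multiset_eqI by metis
      then have "gamma_min d \<le> total (\<lambda>\<pi>. b \<pi> + N * y \<pi>)" by (rule gamma_min_le)
      then show ?thesis unfolding linear b(3) using y by simp
    qed
    \<comment> \<open>Completeness: the pattern vector \<open>x\<close> of an optimal realization
      lies above some \<open>b\<close> in its residue class, and the quotients \<open>y\<close> are
      at most \<open>gamma_min d\<close>, hence within the search range.\<close>
    moreover have "\<exists>(\<beta>, \<sigma>)\<in>set bs. \<exists>z. (\<forall>l<?m. z l \<le> ?n) \<and>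
       (\<forall>j\<le>\<Delta>. \<beta> j + (\<Sum>l<?m. (N * count (mset (ps ! l)) j) * z l) = count_list d j) \<and>
       gamma_min d = \<sigma> + (\<Sum>l<?m. N * z l)"
    proof -
      obtain b where b: "b \<in> B" "\<forall>\<pi>\<in>patterns \<Delta>. b \<pi> \<le> x \<pi> \<and> N dvd x \<pi> - b \<pi>"
        using B(3)[OF \<open>x \<in> A\<close>] by blast
      define y where "y \<pi> = (x \<pi> - b \<pi>) div N" for \<pi>
      have xy: "b \<pi> + N * y \<pi> = x \<pi>" if "\<pi> \<in> patterns \<Delta>" for \<pi>
        using b(2) that by (simp add: y_def)
      have eq: "flat (\<lambda>\<pi>. b \<pi> + N * y \<pi>) = mset d" "total (\<lambda>\<pi>. b \<pi> + N * y \<pi>) = gamma_min d"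
        unfolding x(1,2)[symmetric] using xy by (simp_all add: flat_def pattern_mset_def total_def)
      have "y \<pi> \<le> ?n" for \<pi>
      proof -
        have "y \<pi> \<le> x \<pi>" unfolding y_def by (meson diff_le_self div_le_dividend order_trans)
        then show ?thesis using x(3)[of \<pi>] le by linarith
      qed
      moreover have "count (flat b) j + (\<Sum>l<?m. (N * count (mset (ps ! l)) j) * y (ps ! l))
          = count_list d j" for j
        using linear(1)[of b y j] eq(1) by (simp add: count_mset)
      moreover have "gamma_min d = total b + (\<Sum>l<?m. N * y (ps ! l))"
        using linear(2)[of b y] eq(2) by simp
      moreover have "(count (flat b), total b) \<in> set bs" using b(1) bl by (simp add: bs_def)
      ultimately show ?thesis by (intro bexI[of _ "(count (flat b), total b)"])
          (auto intro!: exI[of _ "\<lambda>l. y (ps ! l)"])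
    qed
    ultimately show "outputs_within P d (gamma_min d) (poly p ?n)"
      using le by (intro P[rule_format]) auto
  qed
qed

end
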